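(* Let $u\in\mathcal{L}PSH^*(\mathbb{C}^n)$ be toric and let $K$ be a compact set containing the unit polydisk $\mathbb{D}^n$. Then \[ \int_{\mathbb{C}^n\setminus K}e^{-2cu}\,d\lambda<\infty \] if and only if \[ c>\sup\left\{\frac{\langle t,\mathbf 1\rangle}{\psi_u(t)}:\ t\in H_+\right\} \] (in other words, $c^{-1}\mathbf 1$ lies in the interior of $\Gamma_{u,\infty}$). Consequently, \[ c_\infty(u)=c_\infty(\Psi_u)=\sup\left\{\frac{\langle t,\mathbf 1\rangle}{\psi_u(t)}:\ t\in H_+\right\}=\inf\{c>0:\ c^{-1}\mathbf 1\in\Gamma_{u,\infty}\}. \]
   Context: $\mathcal{L}PSH(\mathbb{C}^n)$ is the class of plurisubharmonic functions $u$ on $\mathbb{C}^n$ with $\limsup_{|z|\to\infty}u(z)/\log|z|<\infty$; $\mathcal{L}PSH^*(\mathbb{C}^n)$ is the subclass of those with $u(z)\to+\infty$ as $|z|\to\infty$. A function $u$ is toric if $u(z)=u(|z_1|,\ldots,|z_n|)$. The logarithmic indicator of $u\in\mathcal{L}PSH(\mathbb{C}^n)$ is $\Psi_u(z)=\lim_{R\to\infty}R^{-1}\sup\{u(\zeta): |\zeta_k|\le|z_k|^R,\ 1\le k\le n\}$ for $z$ with $z_1\cdots z_n\ne0$, extended to $\mathbb{C}^n$ by continuity; $\psi_u(t)=\Psi_u(e^{t_1},\ldots,e^{t_n})$ for $t\in\mathbb{R}^n$. The indicator diagram of $u$ at infinity is $\Gamma_{u,\infty}=\{a\in\mathbb{R}^n:\langle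 a,t\rangle\le\max\{\psi_u(t),0\}\ \forall t\in\mathbb{R}^n\}$. $\mathbf 1=(1,\ldots,1)$, $H_+=\{t\in\mathbb{R}^n:\sum_kt_k>0\}$, $d\lambda$ is Lebesgue measure. $g\in L^2(\infty)$ means $\int_{\mathbb{C}^n\setminus K'}|g|^2d\lambda<\infty$ for some compact $K'$; $c_\infty(u)=\inf\{c>0:e^{-cu}\in L^2(\infty)\}$. *)

theory Defs
  imports "HOL-Analysis.Analysis"
begin

text \<open>Points of C^n are modelled as complex^'n (the finite type 'n indexes the
coordinates), points of R^n as real^'n.  Plurisubharmonic functions take values
in [-infinity, +infinity), modelled as ereal-valued functions never equal to +infinity.
Lebesgue measure on C^n = R^(2n) is lborel.\<close>

definition usc :: "('a::topological_space \<Rightarrow> ereal) \<Rightarrow> bool" where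
  "usc u \<longleftrightarrow> (\<forall>c::ereal. open {w. u w < c})"

definition circle_integral_ereal :: "(real \<Rightarrow> ereal) \<Rightarrow> ereal" where
  "circle_integral_ereal f =
     enn2ereal (\<integral>\<^sup>+ \<theta>. e2ennreal (f \<theta>) * indicator {0..2*pi} \<theta> \<partial>lborel)
   - enn2ereal (\<integral>\<^sup>+ \<theta>. e2ennreal (- f \<theta>) * indicator {0..2*pi} \<theta> \<partial>lborel)"

definition psh :: "(complex^'n \<Rightarrow> ereal) \<Rightarrow> bool" where
  "psh u \<longleftrightarrow> (\<forall>z. u z < \<infinity>) \<and> usc u \<and>
     (\<forall>a b. ereal (2*pi) * u a
              \<le> circle_integral_ereal (\<lambda>\<theta>. u (\<chi> k. a$k + cis \<theta> * b$k)))"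

definition LPSH :: "(complex^'n \<Rightarrow> ereal) \<Rightarrow> bool" where
  "LPSH u \<longleftrightarrow> psh u \<and>
     (\<exists>C R. \<forall>z. norm z > R \<longrightarrow> u z \<le> ereal (C * ln (norm z)))"

definition LPSH_star :: "(complex^'n \<Rightarrow> ereal) \<Rightarrow> bool" where
  "LPSH_star u \<longleftrightarrow> LPSH u \<and> (u \<longlongrightarrow> \<infinity>) at_infinity"

definition toric :: "(complex^'n \<Rightarrow> ereal) \<Rightarrow> bool" where
  "toric u \<longleftrightarrow> (\<forall>z. u z = u (\<chi> k. complex_of_real (cmod (z$k))))"

definition unit_polydisk :: "(complex^'n) set" where
  "unit_polydisk = {z. \<forall>k. cmod (z$k) < 1}"

definition log_ind0 :: "(complex^'n \<Rightarrow> ereal) \<Rightarrow> complex^'n \<Rightarrow> ereal" where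
  "log_ind0 u z = Lim at_top (\<lambda>R::real.
      (SUP \<zeta>\<in>{\<zeta>. \<forall>k. cmod (\<zeta>$k) \<le> cmod (z$k) powr R}. u \<zeta>) / ereal R)"

definition torus_free :: "(complex^'n) set" where
  "torus_free = {z. \<forall>k. z$k \<noteq> 0}"

definition log_indicator :: "(complex^'n \<Rightarrow> ereal) \<Rightarrow> complex^'n \<Rightarrow> ereal" where
  "log_indicator u z =
     (if z \<in> torus_free then log_ind0 u z
      else Lim (at z within torus_free) (log_ind0 u))"

definition psi_ind :: "(complex^'n \<Rightarrow> ereal) \<Rightarrow> real^'n \<Rightarrow> ereal" where
  "psi_ind u t = log_indicator u (\<chi> k. complex_of_real (exp (t$k)))"

definition indicator_diagram_inf :: "(complex^'n \<Rightarrow> ereal) \<Rightarrow> (real^'n) set" where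
  "indicator_diagram_inf u =
     {a. \<forall>t. ereal (a \<bullet> t) \<le> max (psi_ind u t) 0}"

definition H_plus :: "(real^'n) set" where
  "H_plus = {t. (\<Sum>k\<in>UNIV. t$k) > 0}"

definition one_vec :: "real^'n" where
  "one_vec = (\<chi> k. 1)"

definition exp_neg :: "real \<Rightarrow> ereal \<Rightarrow> ennreal" where
  "exp_neg c x = (case x of ereal r \<Rightarrow> ennreal (exp (- c * r))
                   | PInfty \<Rightarrow> (if c > 0 then 0 else if c = 0 then 1 else \<infinity>)
                   | MInfty \<Rightarrow> (if c > 0 then \<infinity> else if c = 0 then 1 else 0))"

definition L2_inf :: "(complex^'n \<Rightarrow> ennreal) \<Rightarrow> bool" where
  "L2_inf g \<longleftrightarrow> (\<exists>K'. compact K' \<and>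
       (\<integral>\<^sup>+ z. (g z)\<^sup>2 * indicator (- K') z \<partial>lborel) < \<infinity>)"

definition c_inf :: "(complex^'n \<Rightarrow> ereal) \<Rightarrow> ereal" where
  "c_inf u = Inf {ereal c | c. c > 0 \<and> L2_inf (\<lambda>z. exp_neg c (u z))}"

end

theory Submission
  imports Defs "HOL-Complex_Analysis.Cauchy_Integral_Formula"
begin

text \<open>
  In logarithmic coordinates a toric function \<open>u\<close> becomes \<open>\<phi> t = u (exp t)\<close>, and plurisubharmonicity
  makes \<open>\<phi>\<close> convex and coordinatewise nondecreasing. By monotonicity the suprema over polydisks in the
  logarithmic indicator are attained at the corner, so \<open>\<psi>\<close> is the recession function of \<open>\<phi>\<close>;
  it is finite by logarithmic growth, and positive off the closed negative orthant because \<open>u\<close> tends to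
  infinity. Lebesgue measure becomes \<open>exp (2 \<langle>t, 1\<rangle>) dt\<close> up to a constant. If \<open>\<langle>t, 1\<rangle> < c \<psi> t\<close> on \<open>H_plus\<close>, then
  \<open>c \<phi> t - \<langle>t, 1\<rangle>\<close> grows linearly on the cone where some \<open>t_k \<ge> 0\<close> and the integral converges; otherwise
  the integrand is bounded below along a tube around a ray, because \<open>\<phi> \<le> \<phi> 0 + \<psi>\<close>.
  By homogeneity and compactness the supremum of \<open>\<langle>t, 1\<rangle> / \<psi> t\<close> is attained, hence the strict inequality.
  All of this depends on \<open>\<phi>\<close> only through \<open>\<psi>\<close>, and \<open>\<psi>\<close> is its own recession function.
\<close>

section \<open>Upper semicontinuous functions and circle means\<close>

text \<open>The delicate step is convexity of \<open>\<phi>\<close>: \<open>u\<close> is merely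
  upper semicontinuous, may a priori be -\<infinity> even off the coordinate hyperplanes, and is
  neither smoothed nor differentiated. So quadratics touching from above replace second derivatives,
  and the convexity inequality is first proved with real upper bounds at the endpoints; finiteness
  of \<open>\<phi>\<close> is deduced from it. In the mean over a circle the linear part of the
  quadratic vanishes because ln |1 + w| is harmonic, the concave part loses order \<epsilon>^2, and
  the bending of the circle in logarithmic coordinates costs only \<epsilon>^4. The density is never
  transformed as such: unit cells in logarithmic coordinates, whose measures come from a diagonal
  linear scaling, reduce both halves of the integral criterion to series. Convergence needs a gap in
  every direction with some t_k \<ge> 0, since these make up the logarithmic image of the complement
  of the polydisk, whereas the hypothesis speaks of \<open>H_plus\<close> only; the sign of
  \<open>\<psi>\<close> settles the other directions. The gap is uniform because difference
  quotients of a convex function increase to the recession function.\<close>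

lemma usc_attains_max:
  fixes f :: "'a::topological_space \<Rightarrow> ereal"
  assumes "usc f" "compact C" "C \<noteq> {}"
  obtains x where "x \<in> C" "\<And>y. y \<in> C \<Longrightarrow> f y \<le> f x"
proof -
  have "\<exists>x\<in>C. \<forall>y\<in>C. f y \<le> f x"
  proof (rule ccontr)
    assume "\<not> ?thesis"
    \<comment> \<open>Without a maximum these open sublevel sets cover \<open>C\<close>; in a finite
      subcover the point with the largest value \<open>f y\<close> is itself left uncovered.\<close>
    then have "C \<subseteq> (\<Union>y\<in>C. {w. f w < f y})"
      by (force simp: not_le)
    moreover have "\<And>y. y \<in> C \<Longrightarrow> open {w. f w < f y}"
      using assms(1) by (simp add: usc_def)
    ultimately obtain D where D: "D \<subseteq> C" "finite D" "C \<subseteq> (\<Union>y\<in>D. {w. f w < f y})"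
      using compactE_image[OF assms(2), of C "\<lambda>y. {w. f w < f y}"] by auto
    with assms(3) have "D \<noteq> {}" by auto
    then have "Max (f ` D) \<in> f ` D" using D(2) by simp
    then obtain y where y: "y \<in> D" "f y = Max (f ` D)" by auto
    with D obtain y' where "y' \<in> D" "f y < f y'" by blast
    then show False using y D(2) Max_ge[of "f ` D" "f y'"] by (simp add: not_le[symmetric])
  qed
  then show ?thesis using that by blast
qed

lemma usc_compose:
  assumes "usc f" "continuous_on UNIV g"
  shows "usc (\<lambda>x. f (g x))"
  unfolding usc_def
proof
  fix c
  have "open (g -` {w. f w < c})"
    using assms by (intro open_vimage) (auto simp: usc_def)
  then show "open {w. f (g w) < c}" by (simp add: vimage_def)
qed

lemma usc_diff_continuous:
  fixes f :: "'a::topological_space \<Rightarrow> ereal" and q :: "'a \<Rightarrow> real"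
  assumes "usc f" "continuous_on UNIV q"
  shows "usc (\<lambda>x. f x - ereal (q x))"
  unfolding usc_def
proof
  fix c :: ereal
  \<comment> \<open>A real \<open>r\<close> inserted between the two sides separates
    \<open>f\<close> from \<open>q\<close>, so that the sublevel set becomes a union of
    intersections of open sets.\<close>
  have *: "f w - ereal (q w) < ereal d \<longleftrightarrow> (\<exists>r. f w < ereal r \<and> r < d + q w)" for w d
  proof -
    have "f w - ereal (q w) < ereal d \<longleftrightarrow> f w < ereal (d + q w)"
      by (cases "f w") auto
    also have "\<dots> \<longleftrightarrow> (\<exists>r. f w < ereal r \<and> r < d + q w)"
      using ereal_dense2[of "f w" "ereal (d + q w)"]
      by (auto intro: less_trans)
    finally show ?thesis .
  qed
  show "open {w. f w - ereal (q w) < c}"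
  proof (cases c)
    case (real d)
    have "{w. f w - ereal (q w) < c} = (\<Union>r. {w. f w < ereal r} \<inter> {w. r < d + q w})"
      unfolding real * by auto
    moreover have "open \<dots>"
      using assms unfolding usc_def
      by (intro open_UN ballI open_Int open_Collect_less[where f="\<lambda>_. _ :: real"] continuous_intros) auto
    ultimately show ?thesis by simp
  next
    case PInf
    have "{w. f w - ereal (q w) < c} = {w. f w < \<infinity>}"
      unfolding PInf
    proof (intro Collect_cong)
      show "f w - ereal (q w) < \<infinity> \<longleftrightarrow> f w < \<infinity>" for w by (cases "f w") auto
    qed
    then show ?thesis using assms(1) unfolding usc_def by metis
  next
    case MInf
    then show ?thesis by simp
  qed
qed

section \<open>Circle means of continuous functions and of logarithms\<close>

lemma nn_integral_continuous_interval:
  fixes F :: "real \<Rightarrow> real"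
  assumes "continuous_on {a..b} F" 
  shows "(\<integral>\<^sup>+x. ennreal (F x) * indicator {a..b} x \<partial>lborel) = ennreal (integral {a..b} (\<lambda>x. max 0 (F x)))"
proof -
  have "((\<lambda>x. max 0 (F x)) has_integral integral {a..b} (\<lambda>x. max 0 (F x))) {a..b}"
    using assms by (intro integrable_integral integrable_continuous_interval continuous_intros)
  then have "(\<integral>\<^sup>+x. ennreal (max 0 (F x)) * indicator {a..b} x \<partial>lborel) = ennreal (integral {a..b} (\<lambda>x. max 0 (F x)))"
    by (intro nn_integral_has_integral_lebesgue') auto
  moreover have "ennreal (max 0 (F x)) = ennreal (F x)" for x
    by (simp add: max_def ennreal_neg)
  ultimately show ?thesis by simp
qed

lemma circle_integral_ereal_continuous:
  assumes "continuous_on {0..2*pi} F"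
  shows "circle_integral_ereal (\<lambda>\<theta>. ereal (F \<theta>)) = ereal (integral {0..2*pi} F)"
proof -
  let ?P = "integral {0..2*pi} (\<lambda>x. max 0 (F x))" and ?N = "integral {0..2*pi} (\<lambda>x. max 0 (- F x))"
  have int: "(\<lambda>x. max 0 (F x)) integrable_on {0..2*pi}" "(\<lambda>x. max 0 (- F x)) integrable_on {0..2*pi}"
    using assms by (auto intro!: integrable_continuous_interval continuous_intros)
  have pos: "?P \<ge> 0" "?N \<ge> 0"
    by (auto intro!: integral_nonneg int)
  have "circle_integral_ereal (\<lambda>\<theta>. ereal (F \<theta>)) = enn2ereal (ennreal ?P) - enn2ereal (ennreal ?N)"
    unfolding circle_integral_ereal_def
    using nn_integral_continuous_interval[OF assms] 
      nn_integral_continuous_interval[of 0 "2*pi" "\<lambda>x. - F x"] assms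
    by (simp add: continuous_on_minus)
  also have "\<dots> = ereal (?P - ?N)" using pos by (simp add: enn2ereal_ennreal)
  also have "?P - ?N = integral {0..2*pi} (\<lambda>x. max 0 (F x) - max 0 (- F x))"
    using int by (simp add: integral_diff)
  also have "(\<lambda>x. max 0 (F x) - max 0 (- F x)) = F" by (auto simp: max_def)
  finally show ?thesis .
qed

lemma circle_integral_ereal_mono:
  assumes "\<And>\<theta>. \<theta> \<in> {0..2*pi} \<Longrightarrow> f \<theta> \<le> g \<theta>"
  shows "circle_integral_ereal f \<le> circle_integral_ereal g"
  unfolding circle_integral_ereal_def
  using assms
  by (intro ereal_minus_mono)
     (auto intro!: nn_integral_mono e2ennreal_mono simp: less_eq_ennreal.rep_eq[symmetric] split: split_indicator)

text \<open>The only form in which the sub-mean value inequality is applied: with a continuous real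
  majorant no integrability of \<open>u\<close> on the circle has to be settled.\<close>

lemma psh_circle_majorant:
  fixes u :: "complex^'n \<Rightarrow> ereal"
  assumes "psh u" "continuous_on {0..2*pi} F"
    and "\<And>\<theta>. \<theta> \<in> {0..2*pi} \<Longrightarrow> u (\<chi> k. a$k + cis \<theta> * b$k) \<le> ereal (F \<theta>)"
    and "u a = ereal \<alpha>"
  shows "2 * pi * \<alpha> \<le> integral {0..2*pi} F"
proof -
  have "ereal (2*pi) * u a \<le> circle_integral_ereal (\<lambda>\<theta>. u (\<chi> k. a$k + cis \<theta> * b$k))"
    using assms(1) by (simp add: psh_def)
  also have "\<dots> \<le> circle_integral_ereal (\<lambda>\<theta>. ereal (F \<theta>))"
    by (intro circle_integral_ereal_mono assms)
  also have "\<dots> = ereal (integral {0..2*pi} F)"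
    by (rule circle_integral_ereal_continuous) fact
  finally show ?thesis using assms(4) by simp
qed

text \<open>Cauchy's formula for the holomorphic function Ln (1 + z w), whose value at the centre is
  0. The bound on \<open>w\<close> keeps 1 + z w in the right half plane for |z| \<le> 1, away from
  the branch cut.\<close>

lemma has_integral_ln_norm_circle:
  fixes w :: complex
  assumes "cmod w < 1"
  shows "((\<lambda>\<theta>. ln (cmod (1 + cis \<theta> * w))) has_integral 0) {0..2*pi}"
proof -
  have sub: "1 + z * w \<notin> \<real>\<^sub>\<le>\<^sub>0" if "cmod z \<le> 1" for z
  proof -
    have "cmod (z * w) < 1" using that assms by (simp add: norm_mult) (metis mult_left_le_one_le norm_ge_zero order_le_less_trans)
    then have "Re (1 + z * w) > 0" using abs_Re_le_cmod[of "z*w"] by (auto simp: abs_if split: if_splits)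
    then show ?thesis by (auto simp: complex_nonpos_Reals_iff)
  qed
  have hol: "(\<lambda>z. Ln (1 + z * w)) holomorphic_on cball 0 1"
    using sub by (intro holomorphic_intros) auto
  have "((\<lambda>z. Ln (1 + z * w) / (z - 0)) has_contour_integral 2 * complex_of_real pi * \<i> * Ln (1 + 0 * w)) (circlepath 0 1)"
    by (intro Cauchy_integral_circlepath_simple[OF hol]) auto
  then have "((\<lambda>t. Ln (1 + cis t * w) / cis t * \<i> * cis t) has_integral 0) {0..2*pi}"
    by (simp add: circlepath_def has_contour_integral_part_circlepath_iff)
  then have "((\<lambda>t. \<i> * Ln (1 + cis t * w)) has_integral 0) {0..2*pi}"
    by (simp add: mult.commute)
  from has_integral_mult_right[OF this, of "-\<i>"] have "((\<lambda>t. Ln (1 + cis t * w)) has_integral 0) {0..2*pi}"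
    by (simp add: mult.assoc[symmetric])
  from has_integral_linear[OF this bounded_linear_Re] have "((\<lambda>t. Re (Ln (1 + cis t * w))) has_integral 0) {0..2*pi}"
    by (simp add: o_def)
  moreover have "Re (Ln (1 + cis t * w)) = ln (cmod (1 + cis t * w))" for t
    using sub[of "cis t"] by (intro Re_Ln) auto
  ultimately show ?thesis by simp
qed

section \<open>Logarithmic convexity of toric plurisubharmonic functions\<close>

definition exp_vec :: "real^'n \<Rightarrow> complex^'n" where
  "exp_vec t = (\<chi> k. complex_of_real (exp (t$k)))"

lemma exp_vec_nth [simp]: "exp_vec t $ k = complex_of_real (exp (t$k))"
  by (simp add: exp_vec_def)

lemma continuous_on_exp_vec: "continuous_on UNIV (exp_vec :: real^'n \<Rightarrow> complex^'n)"
  unfolding exp_vec_def by (intro continuous_intros)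

definition ln_vec :: "complex^'n \<Rightarrow> real^'n" where
  "ln_vec z = (\<chi> k. ln (cmod (z$k)))"

lemma ln_vec_nth [simp]: "ln_vec z $ k = ln (cmod (z$k))"
  by (simp add: ln_vec_def)

lemma toric_eq_exp_ln_vec:
  assumes "toric u" "z \<in> torus_free"
  shows "u z = u (exp_vec (ln_vec z))"
proof -
  have "(\<chi> k. complex_of_real (cmod (z$k))) = exp_vec (ln_vec z)"
    using assms(2) by (simp add: vec_eq_iff torus_free_def)
  then show ?thesis using assms(1) by (metis toric_def)
qed

lemma has_integral_cos_power2: "((\<lambda>\<theta>. (cos \<theta>)\<^sup>2) has_integral pi) {0..2*pi}"
proof -
  have "((\<lambda>\<theta>. (cos \<theta>)\<^sup>2) has_integral ((2*pi)/2 + sin (2*pi) * cos (2*pi) / 2 - (0/2 + sin 0 * cos 0 / 2))) {0..2*pi}"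
  proof (rule fundamental_theorem_of_calculus)
    fix x :: real
    have "((\<lambda>x. x/2 + sin x * cos x / 2) has_real_derivative (cos x)\<^sup>2) (at x within {0..2*pi})"
      by (rule derivative_eq_intros refl | simp)+
         (simp add: field_simps power2_eq_square sin_squared_eq flip: power2_eq_square)
    then show "((\<lambda>x. x/2 + sin x * cos x / 2) has_vector_derivative (cos x)\<^sup>2) (at x within {0..2*pi})"
      by (simp add: has_real_derivative_iff_has_vector_derivative)
  qed simp
  then show ?thesis by simp
qed

text \<open>First-order expansion of Re (Ln (1 + w)) with Re w = r cos \<theta>; the remainder r^2 /
  (1 - |r|) is at most 2 r^2 when |r| \<le> 1/2.\<close>

lemma ln_norm_one_plus_approx:
  fixes r :: real
  assumes "\<bar>r\<bar> \<le> 1/2"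
  shows "\<bar>ln (cmod (1 + cis \<theta> * of_real r)) - r * cos \<theta>\<bar> \<le> 2 * r\<^sup>2"
proof -
  let ?w = "cis \<theta> * of_real r"
  have n: "cmod ?w = \<bar>r\<bar>" by (simp add: norm_mult)
  have "1 + ?w \<noteq> 0"
  proof
    assume "1 + ?w = 0"
    then have "cmod ?w = 1" by (metis add_eq_0_iff2 norm_minus_cancel norm_one)
    then show False using n assms by simp
  qed
  then have "\<bar>ln (cmod (1 + ?w)) - r * cos \<theta>\<bar> = \<bar>Re (Ln (1 + ?w) - ?w)\<bar>"
    by simp (simp add: mult.commute)
  also have "\<dots> \<le> cmod (Ln (1 + ?w) - ?w)" by (rule abs_Re_le_cmod)
  also have "\<dots> \<le> \<bar>r\<bar>\<^sup>2 / (1 - \<bar>r\<bar>)"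
    using Ln_approx_linear[of ?w] n assms by simp
  also have "\<dots> \<le> \<bar>r\<bar>\<^sup>2 / (1/2)"
    using assms by (intro divide_left_mono) auto
  finally show ?thesis by simp
qed

text \<open>A strictly concave direction \<open>b\<close> of a quadratic touching \<open>u \<circ> exp\<close> from above contradicts the
  mean value inequality on the circles \<open>exp p * (1 + \<epsilon> b cis \<theta>)\<close>: in logarithmic coordinates these
  agree with the segment \<open>p + \<epsilon> cos \<theta> b\<close> up to \<open>O(\<epsilon>\<^sup>2)\<close>, and their coordinatewise mean is exactly \<open>p\<close>.\<close>

lemma toric_psh_no_concave_touching:
  fixes u :: "complex^'n \<Rightarrow> ereal" and b p G :: "real^'n"
  assumes "psh u" "toric u" "b \<noteq> 0" "\<delta> > 0" "N \<ge> 0" "r > 0"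
    and "u (exp_vec p) = ereal \<alpha>"
    and touch: "\<And>v. norm v < r \<Longrightarrow> u (exp_vec (p + v)) \<le>
        ereal (\<alpha> + G \<bullet> v - \<delta> * (b \<bullet> v)\<^sup>2 + N * ((b \<bullet> b) * (v \<bullet> v) - (b \<bullet> v)\<^sup>2))"
  shows False
proof -
  define B where "B = b \<bullet> b"
  have B: "B > 0" using assms(3) by (simp add: B_def)
  have normb: "norm b ^ 2 = B" by (simp add: B_def power2_norm_eq_inner)
  have lim: "((\<lambda>\<epsilon>. \<epsilon> * norm b) \<longlongrightarrow> 0) (at_right 0)"
    "((\<lambda>\<epsilon>. \<epsilon> * norm b + 2 * \<epsilon>\<^sup>2 * B) \<longlongrightarrow> 0) (at_right 0)"
    "((\<lambda>\<epsilon>. 16 * \<epsilon>\<^sup>2 * B * (\<delta> + N)) \<longlongrightarrow> 0) (at_right 0)"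
    by (auto intro!: tendsto_eq_intros)
  \<comment> \<open>The first smallness condition validates the logarithmic expansion in every
    coordinate, the second keeps the curve \<open>L\<close> inside the touching ball, and the third
    makes the mean gain \<delta> \<epsilon>^2 B^2 / 2 * \<pi> exceed the integrated error 8 \<pi>
    \<epsilon>^4 B^3 (\<delta> + N).\<close>
  have "eventually (\<lambda>\<epsilon>::real. \<epsilon> > 0 \<and> \<epsilon> * norm b < 1/2 \<and> \<epsilon> * norm b + 2 * \<epsilon>\<^sup>2 * B < r
      \<and> 16 * \<epsilon>\<^sup>2 * B * (\<delta> + N) < \<delta>) (at_right 0)"
    using order_tendstoD(2)[OF lim(1), of "1/2"] order_tendstoD(2)[OF lim(2) \<open>r > 0\<close>]
      order_tendstoD(2)[OF lim(3) \<open>\<delta> > 0\<close>] eventually_at_right_less[of "0::real"]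
    by (intro eventually_conj) simp_all
  then obtain \<epsilon> where \<epsilon>: "\<epsilon> > 0" "\<epsilon> * norm b < 1/2" "\<epsilon> * norm b + 2 * \<epsilon>\<^sup>2 * B < r"
      "16 * \<epsilon>\<^sup>2 * B * (\<delta> + N) < \<delta>"
    using eventually_happens'[of "at_right (0::real)"] by force
  have comp: "\<bar>\<epsilon> * b$k\<bar> \<le> 1/2" for k
  proof -
    have "\<bar>\<epsilon> * b$k\<bar> \<le> \<epsilon> * norm b" using \<epsilon>(1) component_le_norm_cart[of b k] by (simp add: abs_mult)
    then show ?thesis using \<epsilon>(2) by simp
  qed
  have pos: "cmod (1 + cis \<theta> * of_real (\<epsilon> * b$k)) > 0" for \<theta> k
  proof -
    have "1 + cis \<theta> * of_real (\<epsilon> * b$k) \<noteq> 0"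
    proof
      assume "1 + cis \<theta> * of_real (\<epsilon> * b$k) = 0"
      then have "cmod (cis \<theta> * of_real (\<epsilon> * b$k)) = 1" by (metis add_eq_0_iff2 norm_minus_cancel norm_one)
      then show False using comp[of k] by (simp add: norm_mult)
    qed
    then show ?thesis by simp
  qed
  define L :: "real \<Rightarrow> real^'n" where "L = (\<lambda>\<theta>. \<chi> k. ln (cmod (1 + cis \<theta> * of_real (\<epsilon> * b$k))))"
  define e where "e = (\<lambda>\<theta>. L \<theta> - (\<epsilon> * cos \<theta>) *\<^sub>R b)"
  have L_eq: "L \<theta> = (\<epsilon> * cos \<theta>) *\<^sub>R b + e \<theta>" for \<theta> by (simp add: e_def)
  have e_bound: "norm (e \<theta>) \<le> 2 * \<epsilon>\<^sup>2 * B" for \<theta>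
  proof -
    have "norm (e \<theta>) \<le> (\<Sum>k\<in>UNIV. \<bar>e \<theta> $ k\<bar>)" by (rule norm_le_l1_cart)
    also have "\<dots> \<le> (\<Sum>k\<in>UNIV. 2 * (\<epsilon> * b$k)\<^sup>2)"
      using ln_norm_one_plus_approx[OF comp, of \<theta>]
      by (intro sum_mono) (simp add: e_def L_def mult.assoc mult.commute mult.left_commute)
    also have "\<dots> = 2 * \<epsilon>\<^sup>2 * B"
      by (simp add: B_def inner_vec_def power_mult_distrib sum_distrib_left power2_eq_square mult_ac)
    finally show ?thesis .
  qed
  have L_small: "norm (L \<theta>) < r" for \<theta>
  proof -
    have "norm (L \<theta>) \<le> norm ((\<epsilon> * cos \<theta>) *\<^sub>R b) + norm (e \<theta>)"
      unfolding L_eq by (rule norm_triangle_ineq)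
    also have "norm ((\<epsilon> * cos \<theta>) *\<^sub>R b) \<le> \<epsilon> * norm b"
      using \<epsilon>(1) by (simp add: abs_mult mult_left_le mult_right_mono)
    finally show ?thesis using e_bound[of \<theta>] \<epsilon>(3) by simp
  qed
  \<comment> \<open>The error term stems from \<open>norm (e \<theta>)\<close> \<le> 2 \<epsilon>^2
    B, which gives B |e|^2 \<le> 4 \<epsilon>^4 B^3; it enters once with \<delta> and once with
    N.\<close>
  define F where "F = (\<lambda>\<theta>. \<alpha> + G \<bullet> L \<theta> - \<delta> * (\<epsilon>\<^sup>2 * B\<^sup>2 / 2 * (cos \<theta>)\<^sup>2) + 4 * \<epsilon>^4 * B^3 * (\<delta> + N))"
  have quad: "\<alpha> + G \<bullet> L \<theta> - \<delta> * (b \<bullet> L \<theta>)\<^sup>2 + N * ((b \<bullet> b) * (L \<theta> \<bullet> L \<theta>) - (b \<bullet> L \<theta>)\<^sup>2) \<le> F \<theta>" for \<theta>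
  proof -
    let ?c = "\<epsilon> * cos \<theta>" and ?d = "b \<bullet> e \<theta>" and ?n = "e \<theta> \<bullet> e \<theta>"
    have bL: "b \<bullet> L \<theta> = ?c * B + ?d"
      by (simp add: L_eq inner_add_right B_def)
    have LL: "L \<theta> \<bullet> L \<theta> = ?c\<^sup>2 * B + 2 * ?c * ?d + ?n"
      by (simp add: L_eq inner_add_right inner_add_left B_def power2_eq_square inner_commute algebra_simps)
    have "(norm (e \<theta>))\<^sup>2 \<le> (2 * \<epsilon>\<^sup>2 * B)\<^sup>2"
      by (intro power_mono e_bound) auto
    then have n: "?n \<le> 4 * \<epsilon>^4 * B^2"
      by (simp add: power2_norm_eq_inner power_mult_distrib flip: power_mult)
    have Bn: "B * ?n \<le> 4 * \<epsilon>^4 * B^3"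
      using mult_left_mono[OF n, of B] B by (simp add: power2_eq_square power3_eq_cube mult_ac)
    have d: "?d\<^sup>2 \<le> B * ?n" unfolding B_def by (rule Cauchy_Schwarz_ineq)
    \<comment> \<open>Half of this square is (x + d)^2 - x^2 / 2 + d^2 with x = c B. Giving up half
      of the main term removes the mixed term of order \<epsilon>^3.\<close>
    have "0 \<le> (?c * B + 2 * ?d)\<^sup>2" by simp
    then have "(?c * B + ?d)\<^sup>2 \<ge> (?c * B)\<^sup>2 / 2 - ?d\<^sup>2"
      by (simp add: power2_eq_square algebra_simps)
    then have "(b \<bullet> L \<theta>)\<^sup>2 \<ge> \<epsilon>\<^sup>2 * B\<^sup>2 / 2 * (cos \<theta>)\<^sup>2 - 4 * \<epsilon>^4 * B^3"
      using d Bn unfolding bL by (simp add: power_mult_distrib mult_ac)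
    then have 1: "\<delta> * (b \<bullet> L \<theta>)\<^sup>2 \<ge> \<delta> * (\<epsilon>\<^sup>2 * B\<^sup>2 / 2 * (cos \<theta>)\<^sup>2 - 4 * \<epsilon>^4 * B^3)"
      using \<open>\<delta> > 0\<close> by (intro mult_left_mono) auto
    \<comment> \<open>The transverse form is unchanged by adding multiples of \<open>b\<close>, so
      only the deviation \<open>e\<close> contributes.\<close>
    have "(b \<bullet> b) * (L \<theta> \<bullet> L \<theta>) - (b \<bullet> L \<theta>)\<^sup>2 = B * ?n - ?d\<^sup>2"
      unfolding bL LL B_def[symmetric] by (simp add: power2_eq_square algebra_simps)
    also have "\<dots> \<le> 4 * \<epsilon>^4 * B^3" using Bn zero_le_power2[of ?d] by linarith
    finally have "N * ((b \<bullet> b) * (L \<theta> \<bullet> L \<theta>) - (b \<bullet> L \<theta>)\<^sup>2) \<le> N * (4 * \<epsilon>^4 * B^3)"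
      using \<open>N \<ge> 0\<close> by (rule mult_left_mono)
    with 1 show ?thesis unfolding F_def by (simp add: algebra_simps)
  qed
  have le: "u (\<chi> k. exp_vec p $ k + cis \<theta> * (\<chi> k. of_real (exp (p$k) * (\<epsilon> * b$k))) $ k) \<le> ereal (F \<theta>)" for \<theta>
  proof -
    let ?z = "\<chi> k. exp_vec p $ k + cis \<theta> * (\<chi> k. of_real (exp (p$k) * (\<epsilon> * b$k))) $ k :: complex^'n"
    have z: "?z $ k = of_real (exp (p$k)) * (1 + cis \<theta> * of_real (\<epsilon> * b$k))" for k
      by (simp add: algebra_simps)
    have "u ?z = u (\<chi> k. complex_of_real (cmod (?z $ k)))"
      using assms(2) unfolding toric_def by (rule spec)
    also have "(\<chi> k. complex_of_real (cmod (?z $ k))) = exp_vec (p + L \<theta>)"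
      unfolding vec_eq_iff z using pos[of \<theta>] by (simp add: norm_mult L_def exp_add)
    also have "u (exp_vec (p + L \<theta>)) \<le> ereal (F \<theta>)"
      using order_trans[OF touch[OF L_small]] quad by simp
    finally show ?thesis .
  qed
  have Lint: "((\<lambda>\<theta>. L \<theta> $ k) has_integral 0) {0..2*pi}" for k
    using has_integral_ln_norm_circle[of "of_real (\<epsilon> * b$k)"] comp[of k] by (simp add: L_def norm_mult)
  have "((\<lambda>\<theta>. G \<bullet> L \<theta>) has_integral (\<Sum>k\<in>UNIV. G$k * 0)) {0..2*pi}"
    unfolding inner_vec_def inner_real_def by (intro has_integral_sum has_integral_mult_right Lint) auto
  then have GL: "((\<lambda>\<theta>. G \<bullet> L \<theta>) has_integral 0) {0..2*pi}" by simp
  have c: "((\<lambda>\<theta>. a) has_integral (2*pi*a)) {0..2*pi}" for a :: real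
    using has_integral_const_real[of a 0 "2*pi"] by simp
  have Fint: "(F has_integral 2*pi*\<alpha> + 0 - \<delta> * (\<epsilon>\<^sup>2 * B\<^sup>2 / 2 * pi) + 2*pi*(4 * \<epsilon>^4 * B^3 * (\<delta> + N))) {0..2*pi}"
    unfolding F_def
    by (intro has_integral_add has_integral_diff has_integral_mult_right has_integral_cos_power2 GL c)
  have "continuous_on {0..2*pi} L"
    unfolding L_def using pos by (intro continuous_intros continuous_on_cis) (auto simp: less_le)
  then have "continuous_on {0..2*pi} F"
    unfolding F_def by (intro continuous_intros)
  from psh_circle_majorant[OF assms(1) this le assms(7)]
  have "\<delta> * (\<epsilon>\<^sup>2 * B\<^sup>2 / 2 * pi) \<le> 2*pi*(4 * \<epsilon>^4 * B^3 * (\<delta> + N))"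
    using Fint by (simp add: integral_unique)
  then have "(\<epsilon>\<^sup>2 * B\<^sup>2 * pi / 2) * \<delta> \<le> (\<epsilon>\<^sup>2 * B\<^sup>2 * pi / 2) * (16 * \<epsilon>\<^sup>2 * B * (\<delta> + N))"
    by (simp add: power2_eq_square power3_eq_cube power4_eq_xxxx mult_ac)
  then have "\<delta> \<le> 16 * \<epsilon>\<^sup>2 * B * (\<delta> + N)"
    using \<epsilon>(1) B by (subst (asm) mult_le_cancel_left_pos) auto
  then show False using \<epsilon>(4) by simp
qed

text \<open>If convexity failed on the segment from \<open>x\<close> to \<open>y\<close>, then on a thin cylinder around it \<open>u \<circ> exp\<close> minus a
  quadratic, concave along the axis and steeply convex across it, would attain its maximum in the interior.
  The values \<open>\<alpha>\<close> and \<open>\<beta>\<close> are used because \<open>u\<close> may a priori be \<open>-\<infinity>\<close> at the endpoints.\<close>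

lemma toric_psh_convex_ereal:
  fixes u :: "complex^'n \<Rightarrow> ereal" and x y :: "real^'n"
  assumes "psh u" "toric u" "0 < l" "l < 1"
    and x: "u (exp_vec x) < ereal \<alpha>" and y: "u (exp_vec y) < ereal \<beta>"
  shows "u (exp_vec (x + l *\<^sub>R (y - x))) \<le> ereal (\<alpha> + l * (\<beta> - \<alpha>))"
proof (cases "x = y")
  case True
  have "min \<alpha> \<beta> \<le> \<alpha> + l * (\<beta> - \<alpha>)"
  proof (cases "\<alpha> \<le> \<beta>")
    case True
    then show ?thesis using assms(3) by (simp add: min.coboundedI1)
  next
    case False
    then have "(1 - l) * (\<alpha> - \<beta>) \<ge> 0" using assms(4) by simp
    then show ?thesis using False by (simp add: algebra_simps)
  qed
  moreover have "u (exp_vec x) < ereal (min \<alpha> \<beta>)" using x y True by (simp add: min_def)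
  ultimately have "u (exp_vec x) \<le> ereal (\<alpha> + l * (\<beta> - \<alpha>))"
    by (meson ereal_less_eq(3) less_imp_le order_trans)
  then show ?thesis using True by simp
next
  case False
  define b where "b = y - x"
  define B where "B = b \<bullet> b"
  have B: "B > 0" using False by (simp add: B_def b_def)
  define \<phi> where "\<phi> = (\<lambda>t. u (exp_vec t))"
  have usc: "usc \<phi>"
    unfolding \<phi>_def using usc_compose[OF _ continuous_on_exp_vec, of u] assms(1) by (simp add: psh_def)
  \<comment> \<open>\<open>s\<close> is the coordinate along the axis, 0 at \<open>x\<close> and 1
    at \<open>y\<close>; \<open>P\<close> is \<open>B\<close> times the squared distance from the
    axis.\<close>
  define s where "s = (\<lambda>t. b \<bullet> (t - x) / B)"
  define P where "P = (\<lambda>t. B * ((t - x) \<bullet> (t - x)) - (b \<bullet> (t - x))\<^sup>2)"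
  have P_nonneg: "P t \<ge> 0" for t
    using Cauchy_Schwarz_ineq[of b "t - x"] by (simp add: P_def B_def)
  have contP: "continuous_on A P" for A unfolding P_def by (intro continuous_intros)
  have conts: "continuous_on A s" for A unfolding s_def using B by (intro continuous_intros) auto
  have "open {t. \<phi> t < ereal \<alpha>}" "open {t. \<phi> t < ereal \<beta>}" using usc by (simp_all add: usc_def)
  moreover have "x \<in> {t. \<phi> t < ereal \<alpha>}" "y \<in> {t. \<phi> t < ereal \<beta>}" using x y by (simp_all add: \<phi>_def)
  ultimately obtain r1 r2 where r1: "r1 > 0" "ball x r1 \<subseteq> {t. \<phi> t < ereal \<alpha>}"
    and r2: "r2 > 0" "ball y r2 \<subseteq> {t. \<phi> t < ereal \<beta>}"
    by (meson open_contains_ball)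
  define r where "r = min r1 r2"
  have r: "r > 0" "ball x r \<subseteq> {t. \<phi> t < ereal \<alpha>}" "ball y r \<subseteq> {t. \<phi> t < ereal \<beta>}"
    using r1 r2 by (auto simp: r_def)
  \<comment> \<open>This makes the squared radius of the cylinder r^2 / 2, so that its end faces lie
    in the balls where \<open>\<phi>\<close> stays below \<open>\<alpha>\<close> and
    \<open>\<beta>\<close>.\<close>
  define \<rho> where "\<rho> = B * r\<^sup>2 / 2"
  have \<rho>: "\<rho> > 0" using B r by (simp add: \<rho>_def)
  define C where "C = {t. 0 \<le> s t} \<inter> {t. s t \<le> 1} \<inter> {t. P t \<le> \<rho>}"
  have near: "norm w < r" if "B * (w \<bullet> w) \<le> \<rho>" for w :: "real^'n"
  proof -
    have "w \<bullet> w \<le> r\<^sup>2 / 2" using that B by (simp add: \<rho>_def field_simps)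
    also have "\<dots> < r\<^sup>2" using r(1) by simp
    finally show ?thesis using r(1) by (simp add: power2_norm_eq_inner[symmetric] power2_less_imp_less)
  qed
  have left: "\<phi> t < ereal \<alpha>" if "t \<in> C" "s t = 0" for t
  proof -
    have "b \<bullet> (t - x) = 0" using that(2) B by (simp add: s_def)
    then have "norm (t - x) < r" using that(1) by (intro near) (simp add: C_def P_def)
    then show ?thesis using r(2) by (auto simp: dist_norm norm_minus_commute subset_iff)
  qed
  have right: "\<phi> t < ereal \<beta>" if "t \<in> C" "s t = 1" for t
  proof -
    have bt: "b \<bullet> (t - x) = B" using that(2) B by (simp add: s_def)
    define w where "w = t - y"
    have tx: "t - x = b + w" by (simp add: b_def w_def)
    have bw: "b \<bullet> w = 0" using bt unfolding tx by (simp add: inner_add_right B_def)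
    have tt: "(t - x) \<bullet> (t - x) = B + w \<bullet> w" using bw
      unfolding tx by (simp add: inner_add_right inner_add_left B_def inner_commute)
    have "P t = B * (w \<bullet> w)"
      unfolding P_def bt tt by (simp add: power2_eq_square algebra_simps)
    then have "norm (t - y) < r" using that(1) by (intro near) (simp add: C_def w_def)
    then show ?thesis using r(3) by (auto simp: dist_norm norm_minus_commute subset_iff)
  qed
  have "bounded C"
  proof -
    have "norm (t - x) \<le> sqrt ((\<rho> + B\<^sup>2) / B)" if "t \<in> C" for t
    proof -
      have "0 \<le> b \<bullet> (t - x)" "b \<bullet> (t - x) \<le> B" using that B by (auto simp: C_def s_def field_simps)
      then have "(b \<bullet> (t - x))\<^sup>2 \<le> B\<^sup>2" by (rule power_mono[rotated])
      then have "B * ((t - x) \<bullet> (t - x)) \<le> \<rho> + B\<^sup>2" using that by (simp add: C_def P_def)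
      then have "(norm (t - x))\<^sup>2 \<le> (\<rho> + B\<^sup>2) / B"
        using B by (simp add: field_simps power2_norm_eq_inner)
      then show ?thesis by (simp add: real_le_rsqrt)
    qed
    then have "C \<subseteq> cball x (sqrt ((\<rho> + B\<^sup>2) / B))" by (auto simp: dist_norm norm_minus_commute)
    then show ?thesis using bounded_cball bounded_subset by blast
  qed
  moreover have "closed C"
    unfolding C_def by (intro closed_Int closed_Collect_le conts contP continuous_on_const)
  ultimately have C: "compact C" by (simp add: compact_eq_bounded_closed)
  define m where "m = x + l *\<^sub>R b"
  have m: "s m = l" "P m = 0"
    using B by (simp_all add: m_def s_def P_def B_def power2_eq_square)
  have "m \<in> C" using m assms(3,4) \<rho> by (simp add: C_def)
  obtain q where q: "q \<in> C" "\<And>t. t \<in> C \<Longrightarrow> \<phi> t \<le> \<phi> q"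
    using usc_attains_max[OF usc C] \<open>m \<in> C\<close> by blast
  have fin: "\<phi> t < \<infinity>" for t using assms(1) by (simp add: \<phi>_def psh_def)
  obtain M where M: "\<phi> q < ereal M" using fin[of q] ereal_dense2 by blast
  \<comment> \<open>Steep enough for the barrier \<open>Q\<close> below to reach the upper bound
    \<open>M\<close> of \<open>\<phi>\<close> on the whole lateral face
    \<open>P t = \<rho>\<close>.\<close>
  define N where "N = max 0 ((M - min \<alpha> \<beta>) / \<rho>)"
  have N: "N \<ge> 0" "min \<alpha> \<beta> + N * \<rho> \<ge> M"
  proof -
    have "(M - min \<alpha> \<beta>) / \<rho> * \<rho> \<le> N * \<rho>" unfolding N_def using \<rho> by (intro mult_right_mono) auto
    then show "min \<alpha> \<beta> + N * \<rho> \<ge> M" using \<rho> by simp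
  qed (simp add: N_def)
  have "\<phi> m \<le> ereal (\<alpha> + l * (\<beta> - \<alpha>) + \<delta>)" if "\<delta> > 0" for \<delta>
  proof (rule ccontr)
    \<comment> \<open>Linear interpolation, plus a strictly concave bump vanishing at both ends,
      plus the lateral barrier: \<open>Q\<close> dominates \<open>\<phi>\<close> on the boundary of
      \<open>C\<close> but not at \<open>m\<close>, which forces an interior maximum of the
      difference.\<close>
    define Q where "Q = (\<lambda>t. \<alpha> + s t * (\<beta> - \<alpha>) + \<delta> * (s t * (1 - s t)) + N * P t)"
    have contQ: "continuous_on UNIV Q" unfolding Q_def by (intro continuous_intros conts contP)
    assume "\<not> \<phi> m \<le> ereal (\<alpha> + l * (\<beta> - \<alpha>) + \<delta>)"
    moreover have "Q m \<le> \<alpha> + l * (\<beta> - \<alpha>) + \<delta>"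
    proof -
      have "l * (1 - l) \<le> 1" using assms(3,4) by (simp add: mult_le_one)
      then have "\<delta> * (l * (1 - l)) \<le> \<delta>" using that by (simp add: mult_left_le)
      then show ?thesis by (simp add: Q_def m)
    qed
    ultimately have Qm: "\<phi> m > ereal (Q m)" by (cases "\<phi> m") auto
    obtain p where p: "p \<in> C" "\<And>t. t \<in> C \<Longrightarrow> \<phi> t - ereal (Q t) \<le> \<phi> p - ereal (Q p)"
      using usc_attains_max[OF usc_diff_continuous[OF usc contQ] C] \<open>m \<in> C\<close> by blast
    have "0 < \<phi> m - ereal (Q m)" using Qm by (cases "\<phi> m") auto
    then have "0 < \<phi> p - ereal (Q p)" using p(2)[OF \<open>m \<in> C\<close>] by simp
    then have Qp: "\<phi> p > ereal (Q p)" by (cases "\<phi> p") auto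
    have "s p \<noteq> 0"
    proof
      assume s0: "s p = 0"
      have "\<alpha> \<le> Q p" using N(1) P_nonneg by (simp add: Q_def s0)
      then show False using less_trans[OF Qp left[OF p(1) s0]] by simp
    qed
    moreover have "s p \<noteq> 1"
    proof
      assume s0: "s p = 1"
      have "\<beta> \<le> Q p" using N(1) P_nonneg by (simp add: Q_def s0)
      then show False using less_trans[OF Qp right[OF p(1) s0]] by simp
    qed
    ultimately have sp: "0 < s p" "s p < 1" using p(1) by (auto simp: C_def)
    have "P p \<noteq> \<rho>"
    proof
      assume P0: "P p = \<rho>"
      have "min \<alpha> \<beta> \<le> \<alpha> + s p * (\<beta> - \<alpha>)"
      proof (cases "\<alpha> \<le> \<beta>")
        case True
        then show ?thesis using sp by (simp add: min.coboundedI1)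
      next
        case False
        then have "(1 - s p) * (\<alpha> - \<beta>) \<ge> 0" using sp by simp
        then show ?thesis using False by (simp add: algebra_simps)
      qed
      moreover have "\<delta> * (s p * (1 - s p)) \<ge> 0" using sp that by simp
      ultimately have "M \<le> Q p" using N(2) by (simp add: Q_def P0)
      then show False using less_trans[OF less_le_trans[OF Qp q(2)[OF p(1)]] M] by simp
    qed
    then have Pp: "P p < \<rho>" using p(1) by (simp add: C_def)
    have "open ({t. 0 < s t} \<inter> {t. s t < 1} \<inter> {t. P t < \<rho>})"
      by (intro open_Int open_Collect_less conts contP continuous_on_const)
    with sp Pp obtain r' where r': "r' > 0" "ball p r' \<subseteq> {t. 0 < s t} \<inter> {t. s t < 1} \<inter> {t. P t < \<rho>}"
      by (metis (no_types, lifting) IntI mem_Collect_eq open_contains_ball)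
    then have sub: "ball p r' \<subseteq> C" by (auto simp: C_def subset_iff less_imp_le)
    obtain a where a: "\<phi> p = ereal a" using Qp fin[of p] by (cases "\<phi> p") auto
    \<comment> \<open>The gradient of \<open>Q\<close> at \<open>p\<close>. As \<open>Q\<close> is
      quadratic, the expansion below is exact.\<close>
    define G where "G = ((\<beta> - \<alpha>) / B + \<delta> * (1 - 2 * s p) / B - 2 * N * (b \<bullet> (p - x))) *\<^sub>R b + (2 * N * B) *\<^sub>R (p - x)"
    have expand: "Q (p + v) = Q p + G \<bullet> v - \<delta> / B\<^sup>2 * (b \<bullet> v)\<^sup>2 + N * ((b \<bullet> b) * (v \<bullet> v) - (b \<bullet> v)\<^sup>2)" for v
    proof -
      define h where "h = b \<bullet> v / B"
      define k where "k = b \<bullet> (p - x)"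
      define j where "j = (p - x) \<bullet> v"
      have eq: "p + v - x = (p - x) + v" by simp
      have sv: "s (p + v) = s p + h"
        unfolding s_def eq h_def by (simp only: inner_add_right add_divide_distrib)
      have Pv: "P (p + v) = P p + 2 * B * j - 2 * k * (b \<bullet> v) + (B * (v \<bullet> v) - (b \<bullet> v)\<^sup>2)"
        unfolding P_def eq k_def j_def
        by (simp only: inner_add_right inner_add_left inner_commute[of v "p - x"]) (simp add: power2_eq_square algebra_simps)
      have Gv: "G \<bullet> v = (\<beta> - \<alpha>) * h + \<delta> * (1 - 2 * s p) * h - 2 * N * k * (b \<bullet> v) + 2 * N * B * j"
        unfolding G_def k_def[symmetric] h_def j_def by (simp only: inner_add_left inner_scaleR_left) (simp add: algebra_simps add_divide_distrib diff_divide_distrib)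
      have hh: "\<delta> / B\<^sup>2 * (b \<bullet> v)\<^sup>2 = \<delta> * h\<^sup>2" by (simp add: h_def power_divide)
      show ?thesis
        unfolding hh Gv Q_def sv Pv B_def[symmetric] by (simp add: algebra_simps power2_eq_square)
    qed
    show False
    proof (rule toric_psh_no_concave_touching[OF assms(1,2), of b "\<delta> / B\<^sup>2" N r' p a G])
      show "b \<noteq> 0" using B by (auto simp: B_def)
      show "0 < \<delta> / B\<^sup>2" using B that by simp
      show "u (exp_vec p) = ereal a" using a by (simp add: \<phi>_def)
      show "u (exp_vec (p + v)) \<le> ereal (a + G \<bullet> v - \<delta> / B\<^sup>2 * (b \<bullet> v)\<^sup>2 + N * ((b \<bullet> b) * (v \<bullet> v) - (b \<bullet> v)\<^sup>2))"
        if "norm v < r'" for v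
      proof -
        have "p + v \<in> C" using sub that by (auto simp: dist_norm subset_iff)
        from p(2)[OF this] have "\<phi> (p + v) \<le> ereal (a + (Q (p + v) - Q p))"
          unfolding a by (cases "\<phi> (p + v)") (auto simp: fin)
        then show ?thesis unfolding expand \<phi>_def by (simp add: algebra_simps)
      qed
    qed (use N r' in auto)
  qed
  then have "\<forall>e>0. \<phi> m \<le> ereal (\<alpha> + l * (\<beta> - \<alpha>)) + ereal e" by simp
  then have "\<phi> m \<le> ereal (\<alpha> + l * (\<beta> - \<alpha>))" using ereal_le_epsilon2 by blast
  then show ?thesis by (simp add: \<phi>_def m_def b_def)
qed

section \<open>The logarithmic indicator as a recession function\<close>

lemma convex_slope_mono:
  fixes f :: "'a::real_vector \<Rightarrow> real"
  assumes "convex_on UNIV f" "0 < R" "R \<le> S"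
  shows "(f (R *\<^sub>R t) - f 0) / R \<le> (f (S *\<^sub>R t) - f 0) / S"
proof -
  have "f ((1 - R/S) *\<^sub>R 0 + (R/S) *\<^sub>R (S *\<^sub>R t)) \<le> (1 - R/S) * f 0 + R/S * f (S *\<^sub>R t)"
    using assms by (intro convex_onD) (auto simp: field_simps)
  then have "f (R *\<^sub>R t) - f 0 \<le> R * ((f (S *\<^sub>R t) - f 0) / S)"
    using assms by (simp add: field_simps)
  then show ?thesis using assms by (simp add: pos_divide_le_eq mult.commute)
qed

text \<open>Difference quotients based at 0 increase with \<open>R\<close>, so an eventual bound is
  a bound for all of them and they converge to their supremum; the correction \<open>f 0 / R\<close>
  tends to 0.\<close>

lemma convex_slope_convergent:
  fixes f :: "'a::real_vector \<Rightarrow> real"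
  assumes cvx: "convex_on UNIV f" and bnd: "\<forall>\<^sub>F R in at_top. f (R *\<^sub>R t) / R \<le> M"
  shows "\<exists>l. ((\<lambda>R. f (R *\<^sub>R t) / R) \<longlongrightarrow> l) at_top"
proof -
  define g where "g = (\<lambda>R. (f (R *\<^sub>R t) - f 0) / R)"
  have mono: "g R \<le> g S" if "0 < R" "R \<le> S" for R S
    unfolding g_def by (rule convex_slope_mono[OF cvx that])
  obtain R1 where R1: "\<And>R. R \<ge> R1 \<Longrightarrow> f (R *\<^sub>R t) / R \<le> M"
    using bnd by (auto simp: eventually_at_top_linorder)
  have bdd: "g R \<le> M + \<bar>f 0\<bar>" if "R > 0" for R
  proof -
    define S where "S = max R (max R1 1)"
    have S: "S \<ge> R" "S \<ge> R1" "S \<ge> 1" by (auto simp: S_def)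
    have "- f 0 / S \<le> \<bar>f 0\<bar> / S" using S by (intro divide_right_mono) auto
    also have "\<dots> \<le> \<bar>f 0\<bar>" using S(3) by (simp add: divide_le_eq mult_left_le_one_le mult_le_cancel_left1)
    finally have "g S \<le> M + \<bar>f 0\<bar>" using R1[OF S(2)] by (simp add: g_def diff_divide_distrib)
    then show ?thesis using mono[OF that S(1)] by simp
  qed
  then have bdd': "bdd_above (g ` {0<..})" by (auto simp: bdd_above_def)
  define l where "l = Sup (g ` {0<..})"
  have "(g \<longlongrightarrow> l) at_top"
  proof (rule increasing_tendsto)
    show "\<forall>\<^sub>F R in at_top. g R \<le> l"
      using eventually_gt_at_top[of 0] by eventually_elim (auto simp: l_def intro!: cSup_upper bdd')
    fix x assume "x < l"
    then obtain R where "R > 0" "x < g R"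
      unfolding l_def using less_cSup_iff[of "g ` {0<..}" x] bdd' by (auto simp: ex_in_conv[symmetric])
    then show "\<forall>\<^sub>F S in at_top. x < g S"
      by (intro eventually_mono[OF eventually_ge_at_top[of R]]) (use mono[of R] in force)
  qed
  moreover have "((\<lambda>R. f 0 / R) \<longlongrightarrow> 0) at_top"
    by (intro real_tendsto_divide_at_top[OF tendsto_const] filterlim_ident)
  ultimately have "((\<lambda>R. g R + f 0 / R) \<longlongrightarrow> l + 0) at_top" by (rule tendsto_add)
  then show ?thesis by (auto simp: g_def diff_divide_distrib)
qed

lemma slope_tendsto:
  fixes f :: "'a::real_vector \<Rightarrow> real"
  assumes "((\<lambda>R. f (R *\<^sub>R t) / R) \<longlongrightarrow> l) at_top"
  shows "((\<lambda>R. (f (R *\<^sub>R t) - a) / R) \<longlongrightarrow> l) at_top"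
proof -
  have "((\<lambda>R. a / R) \<longlongrightarrow> 0) at_top"
    by (intro real_tendsto_divide_at_top[OF tendsto_const] filterlim_ident)
  from tendsto_diff[OF assms this] show ?thesis by (simp add: diff_divide_distrib)
qed

lemma convex_slope_le_lim:
  fixes f :: "'a::real_vector \<Rightarrow> real"
  assumes "convex_on UNIV f" "((\<lambda>R. f (R *\<^sub>R t) / R) \<longlongrightarrow> l) at_top" "R > 0"
  shows "(f (R *\<^sub>R t) - f 0) / R \<le> l"
proof (rule tendsto_lowerbound[OF slope_tendsto[OF assms(2)]])
  show "\<forall>\<^sub>F S in at_top. (f (R *\<^sub>R t) - f 0) / R \<le> (f (S *\<^sub>R t) - f 0) / S"
    using eventually_ge_at_top[of R] by eventually_elim (intro convex_slope_mono assms)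
qed simp

text \<open>A decrease from \<open>t\<close> to \<open>t'\<close> would make \<open>f\<close> grow
  at least linearly on the ray running backwards from \<open>t\<close>, against the upper bound
  \<open>M\<close> there.\<close>

lemma convex_imp_mono_if_bounded_below_ray:
  fixes f :: "'a::real_vector \<Rightarrow> real"
  assumes "convex_on UNIV f" "\<And>s. s \<ge> 0 \<Longrightarrow> f (t - s *\<^sub>R (t' - t)) \<le> M"
  shows "f t \<le> f t'"
proof (rule ccontr)
  assume "\<not> f t \<le> f t'"
  then have d: "f t - f t' > 0" by simp
  \<comment> \<open>Far enough back for the forced growth s (f t - f t') to equal |M - f t'|. The
    weight \<open>c\<close> writes \<open>t\<close> as a convex combination of the point at
    parameter \<open>s\<close> and \<open>t'\<close>.\<close>
  define s where "s = \<bar>M - f t'\<bar> / (f t - f t')"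
  have s: "s \<ge> 0" using d by (simp add: s_def)
  define c where "c = s/(1+s)"
  have c: "(1 - c) * (1 + s) = 1" "c - (1 - c) * s = 0" "0 \<le> c" "c \<le> 1"
    using s by (auto simp: c_def field_simps)
  have "(1 - c) *\<^sub>R (t - s *\<^sub>R (t' - t)) + c *\<^sub>R t' = ((1 - c) * (1 + s)) *\<^sub>R t + (c - (1 - c) * s) *\<^sub>R t'"
    by (simp add: algebra_simps)
  then have "f t \<le> (1 - c) * f (t - s *\<^sub>R (t' - t)) + c * f t'"
    using convex_onD[OF assms(1) c(3,4), of "t - s *\<^sub>R (t' - t)" t'] by (simp add: c(1,2))
  also have "\<dots> \<le> (1 - c) * M + c * f t'"
    using assms(2)[OF s] c by (intro add_right_mono mult_left_mono) auto
  finally have "(1 + s) * f t \<le> (1 + s) * ((1 - c) * M + c * f t')"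
    using s by (intro mult_left_mono) auto
  also have "\<dots> = ((1 - c) * (1 + s)) * M + (c * (1 + s)) * f t'" by (simp add: algebra_simps)
  also have "c * (1 + s) = s" using s by (simp add: c_def)
  finally have "(1+s) * f t \<le> M + s * f t'" by (simp add: c)
  then have "(f t - f t') + s * (f t - f t') \<le> M - f t'" by (simp add: algebra_simps)
  moreover have "s * (f t - f t') = \<bar>M - f t'\<bar>" using d by (simp add: s_def)
  ultimately show False using d by linarith
qed

lemma norm_exp_vec_ge: "exp (t$k) \<le> norm (exp_vec t)"
  using Finite_Cartesian_Product.norm_nth_le[of "exp_vec t" k] by simp

lemma norm_exp_vec_le: "norm (exp_vec t) \<le> (\<Sum>k\<in>UNIV. exp (t$k))"
proof -
  have "norm (exp_vec t) \<le> (\<Sum>k\<in>UNIV. norm (exp_vec t $ k))"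
    unfolding norm_vec_def by (rule L2_set_le_sum) simp
  then show ?thesis by simp
qed

section \<open>The function u in logarithmic coordinates\<close>

locale toric_star =
  fixes u :: "complex^'n \<Rightarrow> ereal"
  assumes star: "LPSH_star u" and toric: "toric u"
begin

lemma psh: "psh u"
  using star by (simp add: LPSH_star_def LPSH_def)

lemma less_infinity: "u z < \<infinity>"
  using psh by (simp add: psh_def)

lemma large_at_infinity:
  fixes M :: real
  obtains b where "\<And>z. norm z \<ge> b \<Longrightarrow> u z > ereal M"
proof -
  have "\<forall>\<^sub>F z in at_infinity. u z > ereal M"
    using star by (intro order_tendstoD(1)[of u \<infinity>]) (auto simp: LPSH_star_def)
  then show ?thesis using that by (auto simp: eventually_at_infinity)
qed

definition \<phi> :: "real^'n \<Rightarrow> real" where "\<phi> t = real_of_ereal (u (exp_vec t))"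

text \<open>A value -\<infinity> at \<open>t\<close> lies below every real, in particular below
  \<open>-\<beta>\<close>, where \<open>\<beta>\<close> bounds the value at the reflection of
  \<open>t\<close> in \<open>x\<close>. Convexity then gives at most 0 at the midpoint
  \<open>x\<close>, which was chosen so far out that \<open>u\<close> is positive there.\<close>

lemma u_exp_vec: "u (exp_vec t) = ereal (\<phi> t)"
proof -
  have "u (exp_vec t) \<noteq> -\<infinity>"
  proof
    assume t: "u (exp_vec t) = -\<infinity>"
    obtain b where b: "\<And>z. norm z \<ge> b \<Longrightarrow> u z > ereal 0" using large_at_infinity by blast
    define x :: "real^'n" where "x = (\<chi> k. ln (max b 1))"
    have "norm (exp_vec x) \<ge> max b 1"
      using norm_exp_vec_ge[of x undefined] by (simp add: x_def)
    then have pos: "u (exp_vec x) > 0" using b by (simp add: zero_ereal_def)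
    obtain \<beta> where \<beta>: "u (exp_vec (2 *\<^sub>R x - t)) < ereal \<beta>" using less_infinity ereal_dense2 by blast
    have "2 *\<^sub>R x - t - t = 2 *\<^sub>R (x - t)" by (simp add: scaleR_2)
    then have "t + (1/2) *\<^sub>R (2 *\<^sub>R x - t - t) = x" by simp
    then have "u (exp_vec x) \<le> ereal (-\<beta> + 1/2 * (\<beta> - (-\<beta>)))"
      using toric_psh_convex_ereal[OF psh toric, of "1/2" t "-\<beta>" "2 *\<^sub>R x - t" \<beta>] t \<beta> by simp
    then show False using pos by (simp add: zero_ereal_def[symmetric])
  qed
  then show ?thesis using less_infinity[of "exp_vec t"] by (cases "u (exp_vec t)") (auto simp: \<phi>_def)
qed

lemma convex_\<phi>: "convex_on UNIV \<phi>"
proof (rule convex_onI)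
  fix l :: real and x y :: "real^'n" assume l: "0 < l" "l < 1"
  have e: "(1 - l) *\<^sub>R x + l *\<^sub>R y = x + l *\<^sub>R (y - x)" by (simp add: algebra_simps)
  show "\<phi> ((1 - l) *\<^sub>R x + l *\<^sub>R y) \<le> (1 - l) * \<phi> x + l * \<phi> y"
  proof (rule field_le_epsilon)
    fix d :: real assume "d > 0"
    then have "\<phi> (x + l *\<^sub>R (y - x)) \<le> (\<phi> x + d) + l * ((\<phi> y + d) - (\<phi> x + d))"
      using toric_psh_convex_ereal[OF psh toric l, of x "\<phi> x + d" y "\<phi> y + d"] by (simp add: u_exp_vec)
    then show "\<phi> ((1 - l) *\<^sub>R x + l *\<^sub>R y) \<le> (1 - l) * \<phi> x + l * \<phi> y + d"
      unfolding e by (simp add: algebra_simps)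
  qed
qed simp

text \<open>Moving backwards from \<open>t\<close> shrinks all moduli, so the ray stays in a compact
  ball, on which the upper semicontinuous \<open>u\<close> is bounded above; convexity does the
  rest.\<close>

lemma mono_\<phi>:
  assumes "\<And>k. t$k \<le> t'$k"
  shows "\<phi> t \<le> \<phi> t'"
proof -
  have usc: "usc u" using psh by (simp add: psh_def)
  define C :: "(complex^'n) set" where "C = cball 0 (\<Sum>k\<in>UNIV. exp (t$k))"
  have in_C: "exp_vec (t - s *\<^sub>R (t' - t)) \<in> C" if "s \<ge> 0" for s
  proof -
    have "norm (exp_vec (t - s *\<^sub>R (t' - t))) \<le> (\<Sum>k\<in>UNIV. exp ((t - s *\<^sub>R (t' - t))$k))"
      by (rule norm_exp_vec_le)
    also have "\<dots> \<le> (\<Sum>k\<in>UNIV. exp (t$k))"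
      using assms that by (intro sum_mono) simp
    finally show ?thesis by (simp add: C_def)
  qed
  have "C \<noteq> {}" using in_C[of 0] by auto
  then obtain q where q: "\<And>z. z \<in> C \<Longrightarrow> u z \<le> u q"
    using usc_attains_max[OF usc, of C] by (auto simp: C_def)
  obtain M where "u q < ereal M" using less_infinity ereal_dense2 by blast
  then have "u (exp_vec (t - s *\<^sub>R (t' - t))) \<le> ereal M" if "s \<ge> 0" for s
    using q[OF in_C[OF that]] by simp
  then show ?thesis
    by (intro convex_imp_mono_if_bounded_below_ray[OF convex_\<phi>, of t t' M]) (simp add: u_exp_vec)
qed

text \<open>Zero coordinates of \<open>z\<close> are filled in by a circle centred at \<open>z\<close> on which \<open>u\<close> is constant.\<close>

lemma le_on_polydisk:
  assumes "\<And>k. cmod (z$k) \<le> exp (t$k)"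
  shows "u z \<le> u (exp_vec t)"
proof -
  define b :: "complex^'n" where "b = (\<chi> k. if z$k = 0 then of_real (exp (t$k)) else 0)"
  define x :: "real^'n" where "x = (\<chi> k. if z$k = 0 then t$k else ln (cmod (z$k)))"
  have const: "u (\<chi> k. z$k + cis \<theta> * b$k) = ereal (\<phi> x)" for \<theta>
  proof -
    have "u (\<chi> k. z$k + cis \<theta> * b$k) = u (\<chi> k. complex_of_real (cmod ((\<chi> k. z$k + cis \<theta> * b$k) $ k)))"
      using toric unfolding toric_def by (rule spec)
    also have "(\<chi> k. complex_of_real (cmod ((\<chi> k. z$k + cis \<theta> * b$k) $ k))) = exp_vec x"
      by (simp add: vec_eq_iff x_def b_def norm_mult)
    finally show ?thesis by (simp add: u_exp_vec)
  qed
  have "u z \<le> ereal (\<phi> x)"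
  proof (cases "u z")
    case (real a)
    have "2 * pi * a \<le> integral {0..2*pi} (\<lambda>\<theta>. \<phi> x)"
      using real by (intro psh_circle_majorant[OF psh, where a = z and b = b]) (auto simp: const)
    then show ?thesis using real by simp
  qed (use less_infinity[of z] in auto)
  also have "\<dots> \<le> ereal (\<phi> t)"
  proof -
    have "x$k \<le> t$k" for k
      using assms[of k] ln_le_cancel_iff[of "cmod (z$k)" "exp (t$k)"] by (auto simp: x_def)
    then show ?thesis by (simp add: mono_\<phi>)
  qed
  finally show ?thesis by (simp add: u_exp_vec)
qed

lemma Sup_polydisk:
  assumes "z \<in> torus_free"
  shows "(SUP \<zeta>\<in>{\<zeta>. \<forall>k. cmod (\<zeta>$k) \<le> cmod (z$k) powr R}. u \<zeta>) = ereal (\<phi> (R *\<^sub>R ln_vec z))"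
proof -
  have e: "cmod (z$k) powr R = exp ((R *\<^sub>R ln_vec z) $ k)" for k
    using assms by (simp add: torus_free_def powr_def)
  show ?thesis
    unfolding e
  proof (rule antisym)
    show "(SUP \<zeta>\<in>{\<zeta>. \<forall>k. cmod (\<zeta>$k) \<le> exp ((R *\<^sub>R ln_vec z) $ k)}. u \<zeta>) \<le> ereal (\<phi> (R *\<^sub>R ln_vec z))"
      unfolding u_exp_vec[symmetric] by (rule SUP_least) (use le_on_polydisk in blast)
    show "ereal (\<phi> (R *\<^sub>R ln_vec z)) \<le> (SUP \<zeta>\<in>{\<zeta>. \<forall>k. cmod (\<zeta>$k) \<le> exp ((R *\<^sub>R ln_vec z) $ k)}. u \<zeta>)"
      unfolding u_exp_vec[symmetric] by (rule SUP_upper) simp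
  qed
qed

lemma \<phi>_linear_growth: "\<exists>M. \<forall>\<^sub>F R in at_top. \<phi> (R *\<^sub>R t) / R \<le> M"
proof -
  obtain C R0 where growth: "\<And>z. norm z > R0 \<Longrightarrow> u z \<le> ereal (C * ln (norm z))"
    using star by (auto simp: LPSH_star_def LPSH_def)
  define a where "a = norm t + 1"
  define n where "n = real CARD('n)"
  have n: "n \<ge> 1" unfolding n_def by (simp add: Suc_leI)
  have a: "a \<ge> 1" by (simp add: a_def)
  have "\<phi> (R *\<^sub>R t) / R \<le> \<bar>C\<bar> * (a + ln n)" if R: "R > R0" "R \<ge> 1" for R
  proof -
    \<comment> \<open>A constant vector dominating \<open>R *\<^sub>R t\<close>, whose exponential
      has a norm easily bounded from both sides. Since \<open>a\<close> \<ge> 1, that norm exceeds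
      \<open>R\<close> and hence \<open>R0\<close>; the sign of \<open>C\<close> is unknown, which
      explains the absolute values.\<close>
    define x :: "real^'n" where "x = (\<chi> k. R * a)"
    have ge: "exp (R * a) \<le> norm (exp_vec x)"
      using norm_exp_vec_ge[of x undefined] by (simp add: x_def)
    have le: "norm (exp_vec x) \<le> n * exp (R * a)"
      using norm_exp_vec_le[of x] by (simp add: x_def n_def)
    have pos: "norm (exp_vec x) > 0" using ge by (meson exp_gt_zero less_le_trans)
    have "R \<le> R * a" using R a by simp
    also have "\<dots> < exp (R * a)" using exp_ge_add_one_self[of "R * a"] by linarith
    finally have "norm (exp_vec x) > R0" using ge R by linarith
    from growth[OF this] have "\<phi> x \<le> C * ln (norm (exp_vec x))" by (simp add: u_exp_vec)
    also have "\<dots> \<le> \<bar>C\<bar> * \<bar>ln (norm (exp_vec x))\<bar>" by (metis abs_ge_self abs_mult)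
    also have "\<bar>ln (norm (exp_vec x))\<bar> \<le> R * a + ln n"
    proof -
      have "R * a \<le> ln (norm (exp_vec x))" using ge pos by (simp add: ln_ge_iff)
      moreover have "0 \<le> R * a" using R a by simp
      moreover have "ln (norm (exp_vec x)) \<le> ln (n * exp (R * a))"
        using le pos n by simp
      moreover have "ln (n * exp (R * a)) = ln n + R * a" using n by (simp add: ln_mult)
      ultimately show ?thesis by linarith
    qed
    also have "R * a + ln n \<le> R * (a + ln n)"
      using R n by (simp add: algebra_simps mult_le_cancel_right1)
    finally have "\<phi> x \<le> \<bar>C\<bar> * (R * (a + ln n))" by (simp add: mult_left_mono)
    moreover have "\<phi> (R *\<^sub>R t) \<le> \<phi> x"
    proof (rule mono_\<phi>)
      show "(R *\<^sub>R t) $ k \<le> x $ k" for k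
        using R component_le_norm_cart[of t k] by (simp add: x_def a_def)
    qed
    ultimately show ?thesis using R by (simp add: field_simps)
  qed
  then have "\<forall>\<^sub>F R in at_top. \<phi> (R *\<^sub>R t) / R \<le> \<bar>C\<bar> * (a + ln n)"
    by (intro eventually_mono[OF eventually_conj[OF eventually_gt_at_top[of R0] eventually_ge_at_top[of 1]]]) auto
  then show ?thesis ..
qed

definition \<psi> :: "real^'n \<Rightarrow> real" where "\<psi> t = Lim at_top (\<lambda>R. \<phi> (R *\<^sub>R t) / R)"

lemma \<psi>_lim: "((\<lambda>R. \<phi> (R *\<^sub>R t) / R) \<longlongrightarrow> \<psi> t) at_top"
proof -
  obtain M where "\<forall>\<^sub>F R in at_top. \<phi> (R *\<^sub>R t) / R \<le> M"
    using \<phi>_linear_growth[of t] by (elim exE)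
  then obtain l where l: "((\<lambda>R. \<phi> (R *\<^sub>R t) / R) \<longlongrightarrow> l) at_top"
    using convex_slope_convergent[OF convex_\<phi>] by (elim exE[rotated])
  have "\<psi> t = l" unfolding \<psi>_def by (rule tendsto_Lim[OF _ l]) simp
  with l show ?thesis by (simp only:)
qed

lemma log_indicator_eq:
  assumes "z \<in> torus_free"
  shows "log_indicator u z = ereal (\<psi> (ln_vec z))"
proof -
  have "\<forall>\<^sub>F R in at_top. ereal (\<phi> (R *\<^sub>R ln_vec z) / R) = ereal (\<phi> (R *\<^sub>R ln_vec z)) / ereal R"
    using eventually_gt_at_top[of 0] by eventually_elim simp
  moreover have "((\<lambda>R. ereal (\<phi> (R *\<^sub>R ln_vec z) / R)) \<longlongrightarrow> ereal (\<psi> (ln_vec z))) at_top"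
    using \<psi>_lim by (rule tendsto_ereal)
  ultimately have "((\<lambda>R. ereal (\<phi> (R *\<^sub>R ln_vec z)) / ereal R) \<longlongrightarrow> ereal (\<psi> (ln_vec z))) at_top"
    using tendsto_cong by fastforce
  then have "log_ind0 u z = ereal (\<psi> (ln_vec z))"
    unfolding log_ind0_def Sup_polydisk[OF assms] by (intro tendsto_Lim) auto
  then show ?thesis using assms by (simp add: log_indicator_def)
qed

lemma psi_ind_eq: "psi_ind u t = ereal (\<psi> t)"
proof -
  have "exp_vec t \<in> torus_free" by (simp add: torus_free_def)
  moreover have "ln_vec (exp_vec t) = t" by (simp add: vec_eq_iff)
  ultimately show ?thesis
    unfolding psi_ind_def exp_vec_def[symmetric] by (simp add: log_indicator_eq)
qed

text \<open>Because slopes increase, a single point on the ray with a value above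
  \<open>\<phi> 0\<close> makes the limit positive; growth of \<open>u\<close> at infinity supplies
  such a point.\<close>

lemma \<psi>_pos:
  assumes "t$k > 0"
  shows "\<psi> t > 0"
proof -
  obtain b where b: "\<And>z. norm z \<ge> b \<Longrightarrow> u z > ereal (\<phi> 0)" using large_at_infinity by blast
  define R where "R = max b 1 / t$k"
  have R: "R > 0" using assms by (simp add: R_def)
  have "b \<le> R * t$k" using assms by (simp add: R_def)
  also have "\<dots> \<le> exp (R * t$k)" using exp_ge_add_one_self[of "R * t$k"] by linarith
  also have "\<dots> \<le> norm (exp_vec (R *\<^sub>R t))" using norm_exp_vec_ge[of "R *\<^sub>R t" k] by simp
  finally have "\<phi> (R *\<^sub>R t) > \<phi> 0" using b[of "exp_vec (R *\<^sub>R t)"] by (simp add: u_exp_vec)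
  then have "0 < (\<phi> (R *\<^sub>R t) - \<phi> 0) / R" using R by simp
  also have "\<dots> \<le> \<psi> t"
    by (rule convex_slope_le_lim[OF convex_\<phi> \<psi>_lim R])
  finally show ?thesis .
qed

end

section \<open>Recession functions that are positive off the negative orthant\<close>

lemma inner_one_vec: "t \<bullet> one_vec = (\<Sum>k\<in>UNIV. t$k)"
  by (simp add: one_vec_def inner_vec_def)

lemma H_plus_iff: "t \<in> H_plus \<longleftrightarrow> t \<bullet> one_vec > 0"
  by (simp add: H_plus_def inner_one_vec)

lemma ex_pos_component:
  fixes t :: "real^'n"
  assumes "t \<bullet> one_vec \<ge> 0" "t \<noteq> 0"
  obtains k where "t$k > 0"
proof -
  have "\<exists>k. t$k > 0"
  proof (rule ccontr)
    assume "\<not> ?thesis"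
    then have le: "t$k \<le> 0" for k by (simp add: not_less)
    then have "(\<Sum>k\<in>UNIV. - t$k) = 0"
      using assms(1) by (simp add: inner_one_vec sum_negf) (metis sum_nonpos order_antisym le)
    then have "- t$k = 0" for k
      using sum_nonneg_eq_0_iff[of UNIV "\<lambda>k. - t$k"] le by simp
    then show False using assms(2) by (simp add: vec_eq_iff)
  qed
  then show ?thesis using that by blast
qed

text \<open>Isolates what the integral criterion uses, so that it can be instantiated both for
  \<open>u\<close> in logarithmic coordinates and for its indicator.\<close>

locale recession =
  fixes f \<psi> :: "real^'n \<Rightarrow> real"
  assumes convex: "convex_on UNIV f"
    and lim: "\<And>t. ((\<lambda>R. f (R *\<^sub>R t) / R) \<longlongrightarrow> \<psi> t) at_top"
    and pos: "\<And>t k. t$k > 0 \<Longrightarrow> \<psi> t > 0"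
begin

lemma le_recession: "f t \<le> f 0 + \<psi> t"
  using convex_slope_le_lim[OF convex lim[of t], of 1] by simp

lemma \<psi>_scaleR:
  assumes "s > 0"
  shows "\<psi> (s *\<^sub>R t) = s * \<psi> t"
proof -
  have "filterlim (\<lambda>R::real. R * s) at_top at_top"
    using assms by (intro filterlim_at_top_mult_tendsto_pos[OF tendsto_const _ filterlim_ident])
  from filterlim_compose[OF lim[of t] this]
  have "((\<lambda>R. s * (f ((R * s) *\<^sub>R t) / (R * s))) \<longlongrightarrow> s * \<psi> t) at_top"
    by (intro tendsto_mult_left)
  then have "((\<lambda>R. f (R *\<^sub>R (s *\<^sub>R t)) / R) \<longlongrightarrow> s * \<psi> t) at_top"
    using assms by (simp add: mult.commute)
  then show ?thesis using lim[of "s *\<^sub>R t"] by (intro tendsto_unique[OF _ _ ]) auto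
qed

lemma \<psi>_zero: "\<psi> 0 = 0"
  using \<psi>_scaleR[of 2 0] by simp

text \<open>\<open>x + y\<close> is the midpoint of \<open>2 *\<^sub>R x\<close> and
  \<open>2 *\<^sub>R y\<close>; midpoint convexity of \<open>f\<close> survives the limit, and
  homogeneity absorbs the factors 2.\<close>

lemma \<psi>_add: "\<psi> (x + y) \<le> \<psi> x + \<psi> y"
proof -
  have s: "\<psi> (2 *\<^sub>R z) / 2 = \<psi> z" for z by (simp add: \<psi>_scaleR)
  have l: "((\<lambda>R. f (R *\<^sub>R (2 *\<^sub>R x)) / R / 2 + f (R *\<^sub>R (2 *\<^sub>R y)) / R / 2) \<longlongrightarrow> \<psi> x + \<psi> y) at_top"
    using tendsto_add[OF tendsto_divide[OF lim[of "2 *\<^sub>R x"] tendsto_const[of 2]]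
      tendsto_divide[OF lim[of "2 *\<^sub>R y"] tendsto_const[of 2]]] by (simp add: s)
  show ?thesis
  proof (rule tendsto_le[OF _ l lim])
    have "f (R *\<^sub>R (x + y)) / R \<le> f (R *\<^sub>R (2 *\<^sub>R x)) / R / 2 + f (R *\<^sub>R (2 *\<^sub>R y)) / R / 2" if "R > 0" for R
    proof -
      have "f ((1 - 1/2) *\<^sub>R (R *\<^sub>R (2 *\<^sub>R x)) + (1/2) *\<^sub>R (R *\<^sub>R (2 *\<^sub>R y))) \<le> (1 - 1/2) * f (R *\<^sub>R (2 *\<^sub>R x)) + 1/2 * f (R *\<^sub>R (2 *\<^sub>R y))"
        by (intro convex_onD[OF convex]) auto
      then have "f (R *\<^sub>R (x + y)) \<le> f (R *\<^sub>R (2 *\<^sub>R x)) / 2 + f (R *\<^sub>R (2 *\<^sub>R y)) / 2"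
        by (simp add: scaleR_add_right)
      then show ?thesis using that by (simp add: field_simps)
    qed
    then show "\<forall>\<^sub>F R in at_top. f (R *\<^sub>R (x + y)) / R \<le> f (R *\<^sub>R (2 *\<^sub>R x)) / R / 2 + f (R *\<^sub>R (2 *\<^sub>R y)) / R / 2"
      by (intro eventually_mono[OF eventually_gt_at_top[of 0]]) auto
  qed simp
qed

lemma \<psi>_convex: "convex_on UNIV \<psi>"
proof (rule convex_onI)
  fix l :: real and x y :: "real^'n" assume "0 < l" "l < 1"
  then show "\<psi> ((1 - l) *\<^sub>R x + l *\<^sub>R y) \<le> (1 - l) * \<psi> x + l * \<psi> y"
    using \<psi>_add[of "(1 - l) *\<^sub>R x" "l *\<^sub>R y"] by (simp add: \<psi>_scaleR)
qed simp

lemma continuous_f: "continuous_on A f"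
  using convex_on_continuous[OF open_UNIV convex] continuous_on_subset by blast

lemma continuous_\<psi>: "continuous_on A \<psi>"
  using convex_on_continuous[OF open_UNIV \<psi>_convex] continuous_on_subset by blast

lemma recession_\<psi>: "recession \<psi> \<psi>"
proof
  show "((\<lambda>R. \<psi> (R *\<^sub>R t) / R) \<longlongrightarrow> \<psi> t) at_top" for t
  proof (rule tendsto_eventually)
    show "\<forall>\<^sub>F R in at_top. \<psi> (R *\<^sub>R t) / R = \<psi> t"
      using eventually_gt_at_top[of 0] by eventually_elim (simp add: \<psi>_scaleR)
  qed
qed (auto intro: \<psi>_convex pos)

text \<open>Extends \<open>pos\<close> to the boundary by moving \<open>t\<close> slightly along the
  diagonal; subadditivity bounds the cost by e \<psi>(1), and \<open>e\<close> is chosen to make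
  this \<open>d\<close>.\<close>

lemma \<psi>_nonneg:
  assumes "t$k \<ge> 0"
  shows "\<psi> t \<ge> 0"
proof (rule field_le_epsilon)
  fix d :: real assume d: "d > 0"
  define e where "e = d / \<psi> one_vec"
  have o: "\<psi> one_vec > 0" by (rule pos[of _ k]) (simp add: one_vec_def)
  then have e: "e > 0" using d by (simp add: e_def)
  have "0 < \<psi> (t + e *\<^sub>R one_vec)"
    using assms e by (intro pos[of _ k]) (simp add: one_vec_def)
  also have "\<dots> \<le> \<psi> t + e * \<psi> one_vec"
    using \<psi>_add[of t "e *\<^sub>R one_vec"] by (simp add: \<psi>_scaleR e)
  also have "e * \<psi> one_vec = d" using o by (simp add: e_def)
  finally show "0 \<le> \<psi> t + d" by simp
qed

lemma \<psi>_pos_H_plus: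
  assumes "t \<bullet> one_vec \<ge> 0" "t \<noteq> 0"
  shows "\<psi> t > 0"
  using ex_pos_component[OF assms] pos by metis

text \<open>A Dini argument on the compact set \<open>T\<close> of unit directions with some
  nonnegative coordinate: each direction has a positive quotient \<open>g R t\<close> from some
  radius on, quotients increase with \<open>R\<close>, and a finite subcover yields one radius
  \<open>S\<close> for all. The minimum of \<open>g S\<close> over \<open>T\<close> is the slope
  \<open>\<delta>\<close>.\<close>

lemma coercive:
  assumes c: "c > 0" and crit: "\<And>t. t \<in> H_plus \<Longrightarrow> t \<bullet> one_vec < c * \<psi> t"
  obtains \<delta> C where "\<delta> > 0" "\<And>t k. t$k \<ge> 0 \<Longrightarrow> c * f t - t \<bullet> one_vec \<ge> \<delta> * norm t - C"
proof -
  define T where "T = (\<Union>k. {t::real^'n. 0 \<le> t$k}) \<inter> sphere 0 1"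
  have T: "compact T"
    unfolding T_def by (intro closed_Int_compact closed_UN) (auto simp: closed_halfspace_component_ge_cart)
  define g where "g = (\<lambda>R t. c * ((f (R *\<^sub>R t) - f 0) / R) - t \<bullet> one_vec)"
  have contg: "continuous_on A (g R)" for A R
  proof -
    have "continuous_on A (\<lambda>t. f (R *\<^sub>R t))"
      by (rule continuous_on_compose2[OF continuous_f[of UNIV]]) (auto intro!: continuous_intros)
    then have "continuous_on A (\<lambda>t. c * ((f (R *\<^sub>R t) - f 0) * inverse R) - t \<bullet> one_vec)"
      by (intro continuous_intros)
    then show ?thesis unfolding g_def divide_inverse .
  qed
  have g_mono: "g R t \<le> g S t" if "0 < R" "R \<le> S" for R S t
    unfolding g_def using convex_slope_mono[OF convex that, of t] c
    by (intro diff_right_mono mult_left_mono) auto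
  have "\<exists>n. g (real n + 1) t > 0" if t: "t \<in> T" for t
  proof -
    have "t \<noteq> 0" "\<exists>k. t$k \<ge> 0" using t by (auto simp: T_def)
    then obtain k where k: "t$k \<ge> 0" "t \<noteq> 0" by blast
    \<comment> \<open>\<open>crit\<close> covers \<open>H_plus\<close> only. Where the left side is
      negative, \<open>\<psi>\<close> \<ge> 0 suffices; where it vanishes, \<open>\<psi>\<close> is
      strictly positive.\<close>
    have lt: "t \<bullet> one_vec < c * \<psi> t"
    proof (cases "t \<bullet> one_vec < 0")
      case True
      then show ?thesis using \<psi>_nonneg[OF k(1)] c by (smt (verit) mult_nonneg_nonneg)
    next
      case False
      then show ?thesis using \<psi>_pos_H_plus[of t] crit[of t] k(2) c by (cases "t \<bullet> one_vec = 0") (auto simp: H_plus_iff)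
    qed
    have "filterlim (\<lambda>n. real n + 1) at_top sequentially"
      using filterlim_tendsto_add_at_top[OF tendsto_const[of "1::real"] filterlim_real_sequentially]
      by (simp add: add.commute)
    from filterlim_compose[OF slope_tendsto[OF lim[of t], of "f 0"] this]
    have "(\<lambda>n. g (real n + 1) t) \<longlonglongrightarrow> c * \<psi> t - t \<bullet> one_vec"
      unfolding g_def by (intro tendsto_intros)
    from order_tendstoD(1)[OF this, of 0] lt show ?thesis
      by (auto dest: eventually_happens)
  qed
  then have cover: "T \<subseteq> (\<Union>n\<in>UNIV. {t. 0 < g (real n + 1) t})" by blast
  have op: "\<And>n. n \<in> UNIV \<Longrightarrow> open {t. 0 < g (real n + 1) t}"
    by (intro open_Collect_less contg continuous_on_const)
  obtain D where D: "D \<subseteq> UNIV" "finite D" "T \<subseteq> (\<Union>n\<in>D. {t. 0 < g (real n + 1) t})"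
    by (rule compactE_image[OF T op cover])
  obtain N :: nat where N: "\<And>n. n \<in> D \<Longrightarrow> n < N" using finite_nat_bounded[OF D(2)] by blast
  define S where "S = real N + 1"
  have S: "S > 0" by (simp add: S_def)
  have gS: "g S t > 0" if t: "t \<in> T" for t
  proof -
    obtain n where "n \<in> D" "0 < g (real n + 1) t" using D(3) t by blast
    then show ?thesis using g_mono[of "real n + 1" S t] N[of n] by (simp add: S_def)
  qed
  have "one_vec /\<^sub>R norm (one_vec::real^'n) \<in> T"
    by (auto simp: T_def one_vec_def vec_eq_iff)
  then have "T \<noteq> {}" by blast
  then obtain t0 where t0: "t0 \<in> T" "\<And>t. t \<in> T \<Longrightarrow> g S t0 \<le> g S t"
    using continuous_attains_inf[OF T _ contg] by blast
  define \<delta> where "\<delta> = g S t0"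
  have \<delta>: "\<delta> > 0" using gS t0 by (simp add: \<delta>_def)
  have "continuous_on (cball 0 S) (\<lambda>t. c * f t - t \<bullet> one_vec)"
    by (intro continuous_intros continuous_f)
  moreover have "cball 0 S \<noteq> ({} :: (real^'n) set)" using S by simp
  ultimately obtain t1 where t1: "\<And>t. t \<in> cball 0 S \<Longrightarrow> c * f t1 - t1 \<bullet> one_vec \<le> c * f t - t \<bullet> one_vec"
    using continuous_attains_inf[OF compact_cball] by blast
  \<comment> \<open>The first entry serves \<open>norm t\<close> > \<open>S\<close>, where the
    quotient is based at \<open>f 0\<close>; the second serves the ball of radius \<open>S\<close>,
    where only a minimum is available.\<close>
  define C where "C = max (- c * f 0) (\<delta> * S - (c * f t1 - t1 \<bullet> one_vec))"
  have "c * f t - t \<bullet> one_vec \<ge> \<delta> * norm t - C" if "t$k \<ge> 0" for t k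
  proof (cases "norm t \<le> S")
    case True
    then have "\<delta> * norm t \<le> \<delta> * S" using \<delta> by simp
    moreover have "C \<ge> \<delta> * S - (c * f t1 - t1 \<bullet> one_vec)" by (simp add: C_def)
    ultimately show ?thesis using t1[of t] True by simp
  next
    case False
    then have r: "norm t > 0" "S \<le> norm t" using S by linarith+
    define \<tau> where "\<tau> = t /\<^sub>R norm t"
    have \<tau>: "norm t *\<^sub>R \<tau> = t" using r by (simp add: \<tau>_def)
    have "\<tau> \<in> T" using that r by (auto simp: T_def \<tau>_def intro!: exI[of _ k])
    then have "\<delta> \<le> g (norm t) \<tau>" using t0(2) g_mono[OF S r(2)] unfolding \<delta>_def by (meson order_trans)
    then have "norm t * \<delta> \<le> norm t * g (norm t) \<tau>" using r by simp
    also have "\<dots> = c * (f t - f 0) - (norm t *\<^sub>R \<tau>) \<bullet> one_vec"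
      using r unfolding g_def \<tau> inner_scaleR_left by (simp add: \<tau>_def field_simps)
    finally have "\<delta> * norm t \<le> c * f t - c * f 0 - t \<bullet> one_vec"
      by (simp add: \<tau> algebra_simps)
    moreover have "C \<ge> - c * f 0" by (simp add: C_def)
    ultimately show ?thesis by simp
  qed
  with \<delta> show ?thesis using that by blast
qed

text \<open>The ratio is invariant under scaling and continuous on the closed half sphere, because
  \<open>\<psi>\<close> is positive up to the boundary hyperplane. There the ratio is 0 while the
  diagonal direction gives a positive value, so the maximum lies in the open half space.\<close>

lemma ex_critical_direction:
  obtains t where "t \<in> H_plus" "\<And>s. s \<in> H_plus \<Longrightarrow> s \<bullet> one_vec / \<psi> s \<le> t \<bullet> one_vec / \<psi> t"
proof -
  define S where "S = {t::real^'n. 0 \<le> t \<bullet> one_vec} \<inter> sphere 0 1"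
  have S: "compact S"
    unfolding S_def by (intro closed_Int_compact closed_Collect_le continuous_intros) auto
  have normalize: "s /\<^sub>R norm s \<in> S \<and> (s /\<^sub>R norm s) \<bullet> one_vec / \<psi> (s /\<^sub>R norm s) = s \<bullet> one_vec / \<psi> s"
    if "s \<in> H_plus" for s
  proof -
    have "s \<noteq> 0" using that by (auto simp: H_plus_iff)
    then show ?thesis using that by (auto simp: S_def H_plus_iff \<psi>_scaleR)
  qed
  have one: "(one_vec :: real^'n) \<in> H_plus" by (simp add: H_plus_def one_vec_def)
  have "\<psi> t \<noteq> 0" if "t \<in> S" for t
    using \<psi>_pos_H_plus[of t] that by (force simp: S_def)
  then have "continuous_on S (\<lambda>t. t \<bullet> one_vec / \<psi> t)"
    by (intro continuous_intros continuous_\<psi>) auto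
  moreover have "S \<noteq> {}" using normalize[OF one] by blast
  ultimately obtain t where t: "t \<in> S" "\<And>s. s \<in> S \<Longrightarrow> s \<bullet> one_vec / \<psi> s \<le> t \<bullet> one_vec / \<psi> t"
    using continuous_attains_sup[OF S] by blast
  have le: "s \<bullet> one_vec / \<psi> s \<le> t \<bullet> one_vec / \<psi> t" if "s \<in> H_plus" for s
    using t(2)[of "s /\<^sub>R norm s"] normalize[OF that] by simp
  have "0 < (one_vec :: real^'n) \<bullet> one_vec / \<psi> one_vec"
    using one by (intro divide_pos_pos \<psi>_pos_H_plus) (auto simp: H_plus_iff)
  then have "t \<bullet> one_vec \<noteq> 0" using le[OF one] by auto
  then have "t \<in> H_plus" using t(1) by (simp add: S_def H_plus_iff)
  then show ?thesis using le that by blast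
qed

end

section \<open>Integrals in logarithmic coordinates\<close>

lemma AE_torus_free: "AE z in lborel. z \<in> (torus_free :: (complex^'n) set)"
proof -
  have "AE z in lborel. (z :: complex^'n) $ k \<noteq> 0" for k
  proof -
    have ax: "axis k 1 \<in> (Basis :: (complex^'n) set)" by (auto simp: Basis_vec_def Basis_complex_def)
    \<comment> \<open>This is the real hyperplane Re z_k = 0, which contains z_k = 0.\<close>
    have "{z :: complex^'n. z \<bullet> axis k 1 = 0} \<in> null_sets lebesgue"
      using negligible_standard_hyperplane[OF ax, of 0] by (simp add: negligible_iff_null_sets)
    moreover have "{z :: complex^'n. z \<bullet> axis k 1 = 0} \<in> sets borel"
      by (intro borel_closed closed_Collect_eq continuous_intros)
    ultimately have "{z :: complex^'n. z \<bullet> axis k 1 = 0} \<in> null_sets lborel"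
      by (auto simp: null_sets_def)
    then show ?thesis
      by (rule AE_I') (auto simp: inner_axis)
  qed
  then show ?thesis
    unfolding torus_free_def mem_Collect_eq by (rule eventually_all_finite)
qed

text \<open>The preimage under \<open>ln_vec\<close> of the unit cube with lower corner
  \<open>m\<close>. Neighbouring integer cells share faces, which is harmless in an upper bound; the
  lower bound uses cells that are disjoint.\<close>

definition log_cell :: "real^'n \<Rightarrow> (complex^'n) set" where
  "log_cell m = {z. \<forall>k. exp (m$k) \<le> cmod (z$k) \<and> cmod (z$k) \<le> exp (m$k + 1)}"

lemma closed_log_cell: "closed (log_cell m)"
  unfolding log_cell_def
  by (intro closed_Collect_all closed_Collect_conj closed_Collect_le continuous_intros)

lemma log_cell_borel [simp, measurable]: "log_cell m \<in> sets borel"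
  by (simp add: borel_closed closed_log_cell)

lemma log_cell_torus_free: "log_cell m \<subseteq> torus_free"
proof -
  have "z$k \<noteq> 0" if "z \<in> log_cell m" for z k
  proof -
    have "exp (m$k) \<le> cmod (z$k)" using that by (simp add: log_cell_def)
    then show ?thesis by (metis exp_gt_zero norm_zero not_le)
  qed
  then show ?thesis by (auto simp: torus_free_def)
qed

lemma ln_le_iff_le_exp: "0 < x \<Longrightarrow> ln x \<le> y \<longleftrightarrow> x \<le> exp (y::real)"
  using ln_le_cancel_iff[of x "exp y"] by simp

lemma log_cell_ln_vec:
  assumes "z \<in> log_cell m"
  shows "m$k \<le> ln_vec z $ k" "ln_vec z $ k \<le> m$k + 1"
proof -
  have p: "cmod (z$k) > 0" using assms log_cell_torus_free by (auto simp: torus_free_def)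
  have "exp (m$k) \<le> cmod (z$k)" "cmod (z$k) \<le> exp (m$k + 1)" using assms by (auto simp: log_cell_def)
  then show "m$k \<le> ln_vec z $ k" "ln_vec z $ k \<le> m$k + 1"
    using p by (simp_all add: ln_ge_iff ln_le_iff_le_exp)
qed

lemma prod_Basis_vec:
  fixes h :: "complex^'n \<Rightarrow> 'b::comm_monoid_mult"
  shows "(\<Prod>j\<in>Basis. h j) = (\<Prod>k\<in>UNIV. h (axis k 1) * h (axis k \<i>))"
proof -
  have "(\<Prod>j\<in>Basis. h j) = (\<Prod>k\<in>UNIV. \<Prod>j\<in>{axis k 1, axis k \<i>}. h j)"
    unfolding Basis_vec_def Basis_complex_def
    by (subst prod.UNION_disjoint[symmetric]) (auto simp: axis_eq_axis intro!: prod.cong)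
  also have "\<dots> = (\<Prod>k\<in>UNIV. h (axis k 1) * h (axis k \<i>))"
    by (intro prod.cong) (auto simp: axis_eq_axis)
  finally show ?thesis .
qed

text \<open>Multiplying each z_k by exp m_k carries the cell at 0 onto the cell at \<open>m\<close>.
  The factor 2 in the exponent counts the two real dimensions of each coordinate.\<close>

lemma emeasure_log_cell:
  "emeasure lborel (log_cell (m :: real^'n)) = ennreal (exp (2 * (m \<bullet> one_vec))) * emeasure lborel (log_cell (0 :: real^'n))"
proof -
  \<comment> \<open>Stretching factors indexed by real basis vectors: on \<open>axis k b\<close>
    with \<open>norm b = 1\<close> the sum reduces to exp m_k.\<close>
  define c :: "complex^'n \<Rightarrow> real" where "c = (\<lambda>j. \<Sum>k\<in>UNIV. norm (j$k) * exp (m$k))"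
  have c: "c (axis k b) = exp (m$k)" if "norm b = 1" for k b
  proof -
    have "c (axis k b) = (\<Sum>i\<in>UNIV. if i = k then exp (m$k) else 0)"
      unfolding c_def using that by (intro sum.cong) (auto simp: axis_def)
    then show ?thesis by simp
  qed
  have cB: "c j > 0" if "j \<in> Basis" for j
    using that by (auto simp: Basis_vec_def Basis_complex_def c)
  define T :: "complex^'n \<Rightarrow> complex^'n" where "T = (\<lambda>x. 0 + (\<Sum>j\<in>Basis. (c j * (x \<bullet> j)) *\<^sub>R j))"
  have T: "T x = (\<chi> k. exp (m$k) *\<^sub>R x$k)" for x
  proof (rule euclidean_eqI)
    fix j :: "complex^'n" assume j: "j \<in> Basis"
    then obtain k b where kb: "j = axis k b" "b \<in> Basis" by (auto simp: Basis_vec_def)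
    then have "norm b = 1" by simp
    have "T x \<bullet> j = c j * (x \<bullet> j)" using j by (simp add: T_def inner_sum_left_Basis)
    also have "\<dots> = (\<chi> k. exp (m$k) *\<^sub>R x$k) \<bullet> j" using \<open>norm b = 1\<close> by (simp add: kb c inner_axis)
    finally show "T x \<bullet> j = (\<chi> k. exp (m$k) *\<^sub>R x$k) \<bullet> j" .
  qed
  have pre: "T -` log_cell m = log_cell 0"
    by (auto simp: log_cell_def T exp_add)
  have prod: "(\<Prod>j\<in>Basis. \<bar>c j\<bar>) = exp (2 * (m \<bullet> one_vec))"
  proof -
    have "(\<Prod>j\<in>Basis. \<bar>c j\<bar>) = (\<Prod>k\<in>UNIV. exp (2 * m$k))"
      unfolding prod_Basis_vec by (intro prod.cong) (simp_all add: c flip: exp_add)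
    also have "\<dots> = exp (\<Sum>k\<in>UNIV. 2 * m$k)" by (simp add: exp_sum)
    also have "\<dots> = exp (2 * (m \<bullet> one_vec))" by (simp add: inner_one_vec sum_distrib_left)
    finally show ?thesis .
  qed
  have "lborel = density (distr lborel borel T) (\<lambda>_. (\<Prod>j\<in>Basis. \<bar>c j\<bar>))"
    unfolding T_def using cB by (intro lborel_affine_euclidean) force
  then have "emeasure lborel (log_cell m) = emeasure (density (distr lborel borel T) (\<lambda>_. (\<Prod>j\<in>Basis. \<bar>c j\<bar>))) (log_cell m)"
    by (rule arg_cong)
  also have "\<dots> = ennreal (exp (2 * (m \<bullet> one_vec))) * emeasure (distr lborel borel T) (log_cell m)"
    using log_cell_borel[of m] by (subst emeasure_density) (auto simp: prod nn_integral_cmult)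
  also have "emeasure (distr lborel borel T) (log_cell m) = emeasure lborel (T -` log_cell m)"
    using log_cell_borel[of m] by (subst emeasure_distr) (auto simp: T_def)
  finally show ?thesis by (simp add: pre)
qed

lemma emeasure_log_cell_0: "0 < emeasure lborel (log_cell (0::real^'n))" "emeasure lborel (log_cell (0::real^'n)) < \<infinity>"
proof -
  define U :: "(complex^'n) set" where "U = {z. \<forall>k. 1 < cmod (z$k) \<and> cmod (z$k) < exp 1}"
  have "U = (\<Inter>k. {z. 1 < cmod (z$k)} \<inter> {z. cmod (z$k) < exp 1})" by (auto simp: U_def)
  moreover have "open \<dots>"
    by (intro open_INT open_Int ballI open_Collect_less continuous_intros) auto
  ultimately have "open U" by simp
  moreover have "(\<chi> k. of_real (exp (1/2))) \<in> U" by (simp add: U_def)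
  ultimately obtain z r where z: "r > 0" "ball z r \<subseteq> U" by (meson open_contains_ball)
  have "0 < emeasure lborel (ball z r)"
    using z(1) unit_ball_vol_pos[of "real (DIM(complex^'n))"] by (simp add: emeasure_ball)
  also have "\<dots> \<le> emeasure lborel U"
    using z(2) \<open>open U\<close> by (intro emeasure_mono) auto
  also have "\<dots> \<le> emeasure lborel (log_cell (0::real^'n))"
  proof (rule emeasure_mono)
    show "U \<subseteq> log_cell 0" by (auto simp: U_def log_cell_def less_imp_le)
  qed simp
  finally show "0 < emeasure lborel (log_cell (0::real^'n))" .
  have "bounded (log_cell (0::real^'n))"
  proof -
    have "norm z \<le> (\<Sum>k\<in>(UNIV::'n set). exp 1)" if "z \<in> log_cell (0::real^'n)" for z
    proof -
      have "norm z \<le> (\<Sum>k\<in>UNIV. norm (z$k))"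
        unfolding norm_vec_def by (rule L2_set_le_sum) simp
      also have "\<dots> \<le> (\<Sum>k\<in>(UNIV::'n set). exp 1)" using that by (intro sum_mono) (simp add: log_cell_def)
      finally show ?thesis .
    qed
    then show ?thesis by (auto simp: bounded_iff)
  qed
  then show "emeasure lborel (log_cell (0::real^'n)) < \<infinity>"
    by (rule emeasure_bounded_finite)
qed

lemma exp_neg_ereal [simp]: "exp_neg c (ereal r) = ennreal (exp (- c * r))"
  by (simp add: exp_neg_def)

text \<open>Half of the exponential absorbs the polynomial: with e = exp (\<delta> N / (n + 1)) one
  has 2 N + 1 \<le> M e, so the power is at most M^n e^(n + 1) = M^n exp (\<delta> N), and a
  geometric series remains.\<close>

lemma summable_power_exp:
  assumes "\<delta> > 0"
  shows "summable (\<lambda>N::nat. (2 * real N + 1) ^ n * exp (- 2 * \<delta> * real N))"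
proof -
  define M where "M = 2 * real (Suc n) / \<delta> + 1"
  have le: "(2 * real N + 1) ^ n * exp (- 2 * \<delta> * real N) \<le> M ^ n * exp (- \<delta>) ^ N" for N
  proof -
    define e where "e = exp (\<delta> * real N / real (Suc n))"
    have e1: "e \<ge> 1" using assms by (simp add: e_def)
    have "\<delta> * real N / real (Suc n) \<le> e" unfolding e_def using exp_ge_add_one_self[of "\<delta> * real N / real (Suc n)"] by linarith
    then have "real N \<le> real (Suc n) / \<delta> * e" using assms by (simp add: field_simps del: of_nat_Suc)
    moreover have "M * e = 2 * (real (Suc n) / \<delta> * e) + e" by (simp add: M_def distrib_right del: of_nat_Suc)
    ultimately have "2 * real N + 1 \<le> M * e" using e1 by linarith
    then have "(2 * real N + 1) ^ n \<le> (M * e) ^ n" by (intro power_mono) auto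
    also have "\<dots> = M ^ n * e ^ n" by (rule power_mult_distrib)
    also have "\<dots> \<le> M ^ n * e ^ Suc n"
      using e1 assms by (intro mult_left_mono power_increasing) (auto simp: M_def)
    also have "e ^ Suc n = exp (\<delta> * real N)"
      unfolding e_def exp_of_nat_mult[symmetric] by (simp del: of_nat_Suc)
    finally have "(2 * real N + 1) ^ n * exp (- 2 * \<delta> * real N) \<le> M ^ n * exp (\<delta> * real N) * exp (- 2 * \<delta> * real N)"
      by (intro mult_right_mono) auto
    also have "\<dots> = M ^ n * exp (- \<delta>) ^ N"
      by (simp add: mult.assoc exp_of_nat_mult[symmetric] flip: exp_add)
    finally show ?thesis .
  qed
  have "summable (\<lambda>N. M ^ n * exp (- \<delta>) ^ N)"
    using assms by (intro summable_mult summable_geometric) simp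
  then show ?thesis
  proof (rule summable_comparison_test'[of _ 0])
    show "norm ((2 * real N + 1) ^ n * exp (- 2 * \<delta> * real N)) \<le> M ^ n * exp (- \<delta>) ^ N" for N
      using le[of N] by (simp add: abs_mult)
  qed
qed

section \<open>Convergence and divergence by summing over cells\<close>

context recession
begin

lemma nn_integral_finite:
  fixes w :: "complex^'n \<Rightarrow> ereal"
  assumes w: "\<And>z. z \<in> torus_free \<Longrightarrow> w z = ereal (f (ln_vec z))"
    and "c > 0" "\<And>t. t \<in> H_plus \<Longrightarrow> t \<bullet> one_vec < c * \<psi> t" and K: "unit_polydisk \<subseteq> K"
  shows "(\<integral>\<^sup>+ z. exp_neg (2*c) (w z) * indicator (- K) z \<partial>lborel) < \<infinity>"
proof -
  obtain \<delta> C where \<delta>: "\<delta> > 0" and C: "\<And>t k. t$k \<ge> 0 \<Longrightarrow> c * f t - t \<bullet> one_vec \<ge> \<delta> * norm t - C"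
    using coercive[OF assms(2,3)] by metis
  define vec :: "('n \<Rightarrow> int) \<Rightarrow> real^'n" where "vec = (\<lambda>m. \<chi> k. real_of_int (m k))"
  define Box :: "nat \<Rightarrow> ('n \<Rightarrow> int) set" where "Box = (\<lambda>N. PiE UNIV (\<lambda>_. {- int N..int N}))"
  have finBox: "finite (Box N)" for N unfolding Box_def by (intro finite_PiE) auto
  have cardBox: "real (card (Box N)) = (2 * real N + 1) ^ CARD('n)" for N
    unfolding Box_def by (subst card_PiE) (auto simp: nat_add_distrib add.commute)
  \<comment> \<open>An upper bound for the integrand on a cell with floor vector \<open>m\<close> of
    sup norm N. Rounding gives N \<le> |t| + 1, whence the extra 2 \<delta>. Multiplied by the
    measure of the cell, the bound no longer depends on \<open>m\<close>.\<close>
  define a where "a = (\<lambda>N m. exp (2 * C + 2 * \<delta> - 2 * \<delta> * real N - 2 * (vec m \<bullet> one_vec)))"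
  \<comment> \<open>Each N carries the full box instead of the shell of sup norm N; this overcounts,
    but only polynomially in N.\<close>
  define G where "G = (\<lambda>z. \<Sum>N. \<Sum>m\<in>Box N. ennreal (a N m) * indicator (log_cell (vec m)) z)"
  have bound: "exp_neg (2*c) (w z) * indicator (- K) z \<le> G z" if z: "z \<in> torus_free" for z
  proof (cases "z \<in> K")
    case False
    then have "z \<notin> unit_polydisk" using K by blast
    then obtain k where "cmod (z$k) \<ge> 1" by (auto simp: unit_polydisk_def not_less)
    define t where "t = ln_vec z"
    have "t$k \<ge> 0" using \<open>cmod (z$k) \<ge> 1\<close> by (simp add: t_def)
    define m where "m = (\<lambda>k. \<lfloor>t$k\<rfloor>)"
    define N where "N = Max (range (\<lambda>k. nat \<bar>m k\<bar>))"
    have N: "nat \<bar>m i\<bar> \<le> N" for i unfolding N_def by (intro Max_ge) auto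
    have "N \<in> range (\<lambda>k. nat \<bar>m k\<bar>)" unfolding N_def by (intro Max_in) auto
    then obtain i where i: "N = nat \<bar>m i\<bar>" by auto
    have mBox: "m \<in> Box N"
    proof -
      have "\<bar>m k\<bar> \<le> int N" for k using N[of k] by linarith
      then show ?thesis by (auto simp: Box_def abs_le_iff PiE_def extensional_def minus_le_iff)
    qed
    have cell: "z \<in> log_cell (vec m)"
    proof -
      have p: "cmod (z$k) > 0" for k using z by (simp add: torus_free_def)
      have "real_of_int (m k) \<le> ln (cmod (z$k))" "ln (cmod (z$k)) \<le> real_of_int (m k) + 1" for k
        by (auto simp: m_def t_def) 
      then show ?thesis using p by (simp add: log_cell_def vec_def ln_ge_iff ln_le_iff_le_exp)
    qed
    have "real N \<le> \<bar>t$i\<bar> + 1"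
      using i unfolding m_def by linarith
    also have "\<bar>t$i\<bar> \<le> norm t" by (rule component_le_norm_cart)
    finally have "\<delta> * real N \<le> \<delta> * (norm t + 1)" using \<delta> by simp
    moreover have "vec m \<bullet> one_vec \<le> t \<bullet> one_vec"
      unfolding inner_one_vec by (intro sum_mono) (simp add: vec_def m_def)
    ultimately have "- (2*c) * f t \<le> 2 * C + 2 * \<delta> - 2 * \<delta> * real N - 2 * (vec m \<bullet> one_vec)"
      using C[OF \<open>t$k \<ge> 0\<close>] by (simp add: algebra_simps)
    then have "exp_neg (2*c) (w z) \<le> ennreal (a N m)"
      unfolding w[OF z] t_def[symmetric] exp_neg_ereal a_def by (intro ennreal_leI) simp
    also have "\<dots> = (\<Sum>m\<in>{m}. ennreal (a N m) * indicator (log_cell (vec m)) z)" using cell by simp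
    also have "\<dots> \<le> (\<Sum>m\<in>Box N. ennreal (a N m) * indicator (log_cell (vec m)) z)"
      using mBox finBox by (intro sum_mono2) auto
    also have "\<dots> = (\<Sum>N\<in>{N}. \<Sum>m\<in>Box N. ennreal (a N m) * indicator (log_cell (vec m)) z)" by simp
    also have "\<dots> \<le> G z" unfolding G_def by (intro sum_le_suminf) auto
    finally show ?thesis using False by simp
  qed simp
  obtain v where v: "emeasure lborel (log_cell (0::real^'n)) = ennreal v" "v \<ge> 0"
    using emeasure_log_cell_0(2)[where 'n='n] by (cases "emeasure lborel (log_cell (0::real^'n))") auto
  have "(\<integral>\<^sup>+ z. exp_neg (2*c) (w z) * indicator (- K) z \<partial>lborel) \<le> (\<integral>\<^sup>+ z. G z \<partial>lborel)"
    using AE_torus_free by (intro nn_integral_mono_AE) (auto elim!: eventually_mono intro: bound)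
  also have "\<dots> = (\<Sum>N. \<Sum>m\<in>Box N. ennreal (a N m) * emeasure lborel (log_cell (vec m)))"
    unfolding G_def by (simp add: nn_integral_suminf nn_integral_sum nn_integral_cmult_indicator)
  also have "\<dots> = (\<Sum>N. ennreal (v * exp (2 * C + 2 * \<delta>) * ((2 * real N + 1) ^ CARD('n) * exp (- 2 * \<delta> * real N))))"
  proof (rule arg_cong[where f=suminf], rule ext)
    fix N
    have "(\<Sum>m\<in>Box N. ennreal (a N m) * emeasure lborel (log_cell (vec m)))
        = (\<Sum>m\<in>Box N. ennreal (v * exp (2 * C + 2 * \<delta>) * exp (- 2 * \<delta> * real N)))"
    proof (rule sum.cong)
      fix m
      have "ennreal (a N m) * emeasure lborel (log_cell (vec m)) = ennreal (a N m * exp (2 * (vec m \<bullet> one_vec)) * v)"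
        unfolding emeasure_log_cell[of "vec m"] v(1)
        using v(2) by (simp add: ennreal_mult[symmetric] a_def mult.assoc)
      also have "a N m * exp (2 * (vec m \<bullet> one_vec)) = exp (2 * C + 2 * \<delta>) * exp (- 2 * \<delta> * real N)"
        unfolding a_def by (simp flip: exp_add)
      finally show "ennreal (a N m) * emeasure lborel (log_cell (vec m)) = ennreal (v * exp (2 * C + 2 * \<delta>) * exp (- 2 * \<delta> * real N))"
        by (simp add: mult_ac)
    qed simp
    also have "\<dots> = ennreal (real (card (Box N)) * (v * exp (2 * C + 2 * \<delta>) * exp (- 2 * \<delta> * real N)))"
      using v(2) by (simp add: ennreal_mult ennreal_of_nat_eq_real_of_nat)
    finally show "(\<Sum>m\<in>Box N. ennreal (a N m) * emeasure lborel (log_cell (vec m)))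
        = ennreal (v * exp (2 * C + 2 * \<delta>) * ((2 * real N + 1) ^ CARD('n) * exp (- 2 * \<delta> * real N)))"
      by (simp add: cardBox mult_ac)
  qed
  also have "\<dots> = ennreal (\<Sum>N. v * exp (2 * C + 2 * \<delta>) * ((2 * real N + 1) ^ CARD('n) * exp (- 2 * \<delta> * real N)))"
    using v(2) by (intro suminf_ennreal2 summable_mult summable_power_exp \<delta>) auto
  also have "\<dots> < \<infinity>" by simp
  finally show ?thesis .
qed

text \<open>Along the ray through \<open>t\<close> the decay of the integrand is outweighed by the
  growth of cell measures, so infinitely many disjoint cells outside \<open>K\<close> each
  contribute at least the same positive amount.\<close>

lemma nn_integral_infinite:
  fixes w :: "complex^'n \<Rightarrow> ereal"
  assumes w: "\<And>z. z \<in> torus_free \<Longrightarrow> w z = ereal (f (ln_vec z))"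
    and "c > 0" and t: "t \<in> H_plus" "c * \<psi> t \<le> t \<bullet> one_vec" and K: "compact K"
  shows "(\<integral>\<^sup>+ z. exp_neg (2*c) (w z) * indicator (- K) z \<partial>lborel) = \<infinity>"
proof -
  have "t \<bullet> one_vec \<ge> 0" "t \<noteq> 0" using t(1) by (auto simp: H_plus_iff)
  then obtain k where k: "t$k > 0" by (rule ex_pos_component)
  \<comment> \<open>With k-th coordinate 2, distinct integer multiples differ there by at least 2,
    so cells of side 1 attached to them are disjoint.\<close>
  define \<tau> where "\<tau> = (2 / t$k) *\<^sub>R t"
  have \<tau>k: "\<tau>$k = 2" using k by (simp add: \<tau>_def)
  have \<tau>: "c * \<psi> \<tau> \<le> \<tau> \<bullet> one_vec"
  proof -
    have "(2 / t$k) * (c * \<psi> t) \<le> (2 / t$k) * (t \<bullet> one_vec)" using t(2) k by (intro mult_left_mono) auto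
    then show ?thesis using k by (simp add: \<tau>_def \<psi>_scaleR mult.left_commute)
  qed
  \<comment> \<open>This ball contains the unit cube, hence every offset from the lower corner of a
    cell; the maximum of \<open>\<psi>\<close> on it bounds the effect of the offset.\<close>
  have ne: "cball 0 (real CARD('n)) \<noteq> ({} :: (real^'n) set)" by simp
  obtain v0 where v0: "\<And>v. v \<in> cball 0 (real CARD('n)) \<Longrightarrow> \<psi> v \<le> \<psi> v0"
    using continuous_attains_sup[OF compact_cball ne continuous_\<psi>] by blast
  obtain b where b: "\<And>z. z \<in> K \<Longrightarrow> norm z \<le> b"
    using compact_imp_bounded[OF K] by (auto simp: bounded_iff)
  \<comment> \<open>Starting at \<open>s0\<close> puts |z_k| \<ge> exp (2 h) above the bound
    \<open>b\<close> on \<open>K\<close>.\<close>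
  define s0 where "s0 = nat \<lceil>\<bar>b\<bar>\<rceil> + 1"
  define A where "A = 2 * c * (f 0 + \<psi> v0)"
  define h where "h = (\<lambda>s::nat. real (s + s0))"
  define cell where "cell = (\<lambda>s. log_cell (h s *\<^sub>R \<tau>))"
  define a where "a = (\<lambda>s. exp (- A - 2 * h s * (\<tau> \<bullet> one_vec)))"
  have hpos: "h s > 0" for s unfolding h_def s0_def by linarith
  have disj: "disjoint_family cell"
    unfolding disjoint_family_on_def
  proof (intro ballI impI)
    fix s s' :: nat assume "s \<noteq> s'"
    show "cell s \<inter> cell s' = {}"
    proof (rule ccontr)
      assume "cell s \<inter> cell s' \<noteq> {}"
      then obtain z where z: "z \<in> cell s" "z \<in> cell s'" by blast
      have "2 * h s \<le> ln_vec z $ k" "ln_vec z $ k \<le> 2 * h s + 1"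
        "2 * h s' \<le> ln_vec z $ k" "ln_vec z $ k \<le> 2 * h s' + 1"
        using log_cell_ln_vec[of z "h s *\<^sub>R \<tau>" k] log_cell_ln_vec[of z "h s' *\<^sub>R \<tau>" k] z by (simp_all add: cell_def \<tau>k mult.commute)
      then have "\<bar>h s - h s'\<bar> \<le> 1/2" by linarith
      then have "s = s'" unfolding h_def by linarith
      with \<open>s \<noteq> s'\<close> show False by simp
    qed
  qed
  have bound: "ennreal (a s) \<le> exp_neg (2*c) (w z) * indicator (- K) z" if "z \<in> cell s" for s z
  proof -
    have tf: "z \<in> torus_free" using that log_cell_torus_free by (auto simp: cell_def)
    define v where "v = ln_vec z - h s *\<^sub>R \<tau>"
    have v: "0 \<le> v$i" "v$i \<le> 1" for i
      using log_cell_ln_vec[of z "h s *\<^sub>R \<tau>" i] that by (auto simp: v_def cell_def)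
    have "norm v \<le> (\<Sum>i\<in>UNIV. \<bar>v$i\<bar>)" by (rule norm_le_l1_cart)
    also have "\<dots> \<le> (\<Sum>i\<in>(UNIV::'n set). 1)" using v by (intro sum_mono) simp
    finally have "\<psi> v \<le> \<psi> v0" by (intro v0) simp
    have "f (ln_vec z) \<le> f 0 + \<psi> (h s *\<^sub>R \<tau> + v)" using le_recession[of "ln_vec z"] by (simp add: v_def)
    also have "\<psi> (h s *\<^sub>R \<tau> + v) \<le> h s * \<psi> \<tau> + \<psi> v" using \<psi>_add[of "h s *\<^sub>R \<tau>" v] by (simp add: \<psi>_scaleR hpos)
    finally have "f (ln_vec z) \<le> f 0 + \<psi> v0 + h s * \<psi> \<tau>" using \<open>\<psi> v \<le> \<psi> v0\<close> by simp
    then have "c * f (ln_vec z) \<le> c * (f 0 + \<psi> v0 + h s * \<psi> \<tau>)" using \<open>c > 0\<close> by simp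
    also have "\<dots> = c * (f 0 + \<psi> v0) + h s * (c * \<psi> \<tau>)" by (simp add: algebra_simps)
    also have "h s * (c * \<psi> \<tau>) \<le> h s * (\<tau> \<bullet> one_vec)" using \<tau> hpos[of s] by simp
    finally have "- A - 2 * h s * (\<tau> \<bullet> one_vec) \<le> - (2*c) * f (ln_vec z)" by (simp add: A_def)
    then have "ennreal (a s) \<le> exp_neg (2*c) (w z)"
      unfolding w[OF tf] exp_neg_ereal a_def by (intro ennreal_leI) simp
    moreover have "z \<notin> K"
    proof
      assume "z \<in> K"
      have "b < h s" unfolding h_def s0_def by linarith
      also have "\<dots> \<le> exp (2 * h s)" using exp_ge_add_one_self[of "2 * h s"] hpos[of s] by linarith
      also have "\<dots> \<le> cmod (z$k)" using that by (simp add: cell_def log_cell_def \<tau>k mult.commute)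
        (metis \<tau>k mult.commute)
      also have "\<dots> \<le> norm z" by (rule Finite_Cartesian_Product.norm_nth_le)
      finally show False using b[OF \<open>z \<in> K\<close>] by simp
    qed
    ultimately show ?thesis by simp
  qed
  obtain v where v: "emeasure lborel (log_cell (0::real^'n)) = ennreal v" "v > 0"
    using emeasure_log_cell_0[where 'n='n] by (cases "emeasure lborel (log_cell (0::real^'n))") (auto simp: ennreal_zero_less_top)
  have "(\<Sum>s. ennreal (exp (- A) * v)) = (\<Sum>s. ennreal (a s) * emeasure lborel (cell s))"
  proof (rule arg_cong[where f=suminf], rule ext)
    fix s
    have "ennreal (a s) * emeasure lborel (cell s) = ennreal (a s * exp (2 * ((h s *\<^sub>R \<tau>) \<bullet> one_vec)) * v)"
      unfolding cell_def emeasure_log_cell[of "h s *\<^sub>R \<tau>"] v(1)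
      using v(2) by (simp add: ennreal_mult[symmetric] a_def mult.assoc)
    also have "a s * exp (2 * ((h s *\<^sub>R \<tau>) \<bullet> one_vec)) = exp (- A)"
      unfolding a_def by (simp flip: exp_add)
    finally show "ennreal (exp (- A) * v) = ennreal (a s) * emeasure lborel (cell s)" by simp
  qed
  also have "\<dots> = (\<integral>\<^sup>+ z. (\<Sum>s. ennreal (a s) * indicator (cell s) z) \<partial>lborel)"
    by (simp add: nn_integral_suminf nn_integral_cmult_indicator cell_def)
  also have "\<dots> \<le> (\<integral>\<^sup>+ z. exp_neg (2*c) (w z) * indicator (- K) z \<partial>lborel)"
  proof (rule nn_integral_mono)
    fix z
    show "(\<Sum>s. ennreal (a s) * indicator (cell s) z) \<le> exp_neg (2*c) (w z) * indicator (- K) z"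
    proof (cases "\<exists>s. z \<in> cell s")
      case True
      then obtain s where s: "z \<in> cell s" by blast
      have "(\<Sum>s. ennreal (a s) * indicator (cell s) z) = ennreal (a s)"
        using suminf_cmult_indicator[OF disj s, of "\<lambda>s. ennreal (a s)"] by simp
      then show ?thesis using bound[OF s] by simp
    qed simp
  qed
  finally have le: "(\<Sum>s::nat. ennreal (exp (- A) * v)) \<le> (\<integral>\<^sup>+ z. exp_neg (2*c) (w z) * indicator (- K) z \<partial>lborel)" .
  have "(\<Sum>s::nat. ennreal (exp (- A) * v)) = \<infinity>"
  proof (rule ccontr)
    assume "(\<Sum>s::nat. ennreal (exp (- A) * v)) \<noteq> \<infinity>"
    then have "summable (\<lambda>s::nat. exp (- A) * v)" using v(2) by (intro summable_suminf_not_top) auto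
    then show False using v(2) by (simp add: summable_const_iff)
  qed
  then show ?thesis using le by (simp add: top_unique)
qed

end

section \<open>Critical exponents\<close>

lemma power2_exp_neg:
  assumes "c > 0"
  shows "(exp_neg c x)\<^sup>2 = exp_neg (2 * c) x"
proof (cases x)
  case (real r)
  have "(exp (- c * r))\<^sup>2 = exp (- (2 * c) * r)" by (simp add: power2_eq_square flip: exp_add)
  then show ?thesis by (simp add: real ennreal_power)
qed (use assms in \<open>auto simp: exp_neg_def power2_eq_square ennreal_top_mult\<close>)

lemma Inf_ereal_greaterThan:
  assumes "\<sigma> > (0::real)"
  shows "Inf {ereal c | c. c > 0 \<and> c > \<sigma>} = ereal \<sigma>"
proof (rule antisym)
  show "ereal \<sigma> \<le> Inf {ereal c | c. c > 0 \<and> c > \<sigma>}"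
    by (rule Inf_greatest) auto
  show "Inf {ereal c | c. c > 0 \<and> c > \<sigma>} \<le> ereal \<sigma>"
  proof (rule ereal_le_epsilon2[rule_format, rotated])
    fix e :: real assume "e > 0"
    then show "Inf {ereal c | c. c > 0 \<and> c > \<sigma>} \<le> ereal \<sigma> + ereal e"
      using assms by (intro Inf_lower) auto
  qed
qed

context recession
begin

text \<open>Attainment makes the first equivalence strict on both sides. The integrals and the
  interior of the diagram are compared with it, membership in the diagram with the second.\<close>

lemma SUP_attained:
  obtains \<sigma> where "\<sigma> > 0" "(SUP t\<in>H_plus. ereal (t \<bullet> one_vec) / ereal (\<psi> t)) = ereal \<sigma>"
    "\<And>c. c > 0 \<Longrightarrow> \<sigma> < c \<longleftrightarrow> (\<forall>t\<in>H_plus. t \<bullet> one_vec < c * \<psi> t)"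
    "\<And>c. c > 0 \<Longrightarrow> \<sigma> \<le> c \<longleftrightarrow> (\<forall>t\<in>H_plus. t \<bullet> one_vec \<le> c * \<psi> t)"
proof -
  obtain t where t: "t \<in> H_plus" and max: "\<And>s. s \<in> H_plus \<Longrightarrow> s \<bullet> one_vec / \<psi> s \<le> t \<bullet> one_vec / \<psi> t"
    using ex_critical_direction by blast
  define \<sigma> where "\<sigma> = t \<bullet> one_vec / \<psi> t"
  have pos: "\<psi> s > 0" if "s \<in> H_plus" for s
    using that by (intro \<psi>_pos_H_plus) (auto simp: H_plus_iff)
  have "\<sigma> > 0" using t pos[OF t] by (simp add: \<sigma>_def H_plus_iff)
  moreover have "(SUP s\<in>H_plus. ereal (s \<bullet> one_vec) / ereal (\<psi> s)) = ereal \<sigma>"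
  proof (rule antisym)
    show "(SUP s\<in>H_plus. ereal (s \<bullet> one_vec) / ereal (\<psi> s)) \<le> ereal \<sigma>"
    proof (rule SUP_least)
      fix s :: "real^'n" assume "s \<in> H_plus"
      then show "ereal (s \<bullet> one_vec) / ereal (\<psi> s) \<le> ereal \<sigma>"
        using max[of s] pos[of s] by (simp add: \<sigma>_def)
    qed
    have "ereal \<sigma> = ereal (t \<bullet> one_vec) / ereal (\<psi> t)" using pos[OF t] by (simp add: \<sigma>_def)
    then show "ereal \<sigma> \<le> (SUP s\<in>H_plus. ereal (s \<bullet> one_vec) / ereal (\<psi> s))"
      by (simp only:) (rule SUP_upper[OF t])
  qed
  moreover have "\<sigma> < c \<longleftrightarrow> (\<forall>s\<in>H_plus. s \<bullet> one_vec < c * \<psi> s)" for c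
  proof -
    have "\<sigma> < c \<longleftrightarrow> (\<forall>s\<in>H_plus. s \<bullet> one_vec / \<psi> s < c)"
      using max t unfolding \<sigma>_def by (meson le_less_trans)
    also have "\<dots> \<longleftrightarrow> (\<forall>s\<in>H_plus. s \<bullet> one_vec < c * \<psi> s)"
      using pos by (intro ball_cong) (auto simp: pos_divide_less_eq)
    finally show ?thesis .
  qed
  moreover have "\<sigma> \<le> c \<longleftrightarrow> (\<forall>s\<in>H_plus. s \<bullet> one_vec \<le> c * \<psi> s)" for c
  proof -
    have "\<sigma> \<le> c \<longleftrightarrow> (\<forall>s\<in>H_plus. s \<bullet> one_vec / \<psi> s \<le> c)"
      using max t unfolding \<sigma>_def by (meson order_trans)
    also have "\<dots> \<longleftrightarrow> (\<forall>s\<in>H_plus. s \<bullet> one_vec \<le> c * \<psi> s)"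
      using pos by (intro ball_cong) (auto simp: pos_divide_le_eq)
    finally show ?thesis .
  qed
  ultimately show ?thesis using that by blast
qed

lemma nn_integral_finite_iff:
  fixes w :: "complex^'n \<Rightarrow> ereal"
  assumes "\<And>z. z \<in> torus_free \<Longrightarrow> w z = ereal (f (ln_vec z))"
    and "c > 0" "unit_polydisk \<subseteq> K" "compact K"
  shows "(\<integral>\<^sup>+ z. exp_neg (2*c) (w z) * indicator (- K) z \<partial>lborel) < \<infinity>
      \<longleftrightarrow> (\<forall>t\<in>H_plus. t \<bullet> one_vec < c * \<psi> t)"
proof
  assume fin: "(\<integral>\<^sup>+ z. exp_neg (2*c) (w z) * indicator (- K) z \<partial>lborel) < \<infinity>"
  show "\<forall>t\<in>H_plus. t \<bullet> one_vec < c * \<psi> t"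
  proof (rule ccontr)
    assume "\<not> ?thesis"
    then obtain t where "t \<in> H_plus" "c * \<psi> t \<le> t \<bullet> one_vec" by (auto simp: not_less)
    from nn_integral_infinite[OF assms(1,2) this assms(4)] fin show False by simp
  qed
next
  assume "\<forall>t\<in>H_plus. t \<bullet> one_vec < c * \<psi> t"
  then show "(\<integral>\<^sup>+ z. exp_neg (2*c) (w z) * indicator (- K) z \<partial>lborel) < \<infinity>"
    using nn_integral_finite[OF assms(1,2) _ assms(3)] by blast
qed

text \<open>The compact set in \<open>L2_inf\<close> may miss part of the unit polydisk; adding the
  ball \<open>D\<close> to it only shrinks the domain of integration and makes the integral
  criterion applicable.\<close>

lemma L2_inf_iff:
  fixes w :: "complex^'n \<Rightarrow> ereal"
  assumes w: "\<And>z. z \<in> torus_free \<Longrightarrow> w z = ereal (f (ln_vec z))" and c: "c > 0"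
  shows "L2_inf (\<lambda>z. exp_neg c (w z)) \<longleftrightarrow> (\<forall>t\<in>H_plus. t \<bullet> one_vec < c * \<psi> t)"
proof -
  define D :: "(complex^'n) set" where "D = cball 0 (real CARD('n))"
  have D: "compact D" "unit_polydisk \<subseteq> D"
  proof -
    have "norm z \<le> real CARD('n)" if "z \<in> unit_polydisk" for z :: "complex^'n"
    proof -
      have "norm z \<le> (\<Sum>k\<in>UNIV. norm (z$k))"
        unfolding norm_vec_def by (rule L2_set_le_sum) simp
      also have "\<dots> \<le> (\<Sum>k\<in>(UNIV::'n set). 1)"
        using that by (intro sum_mono) (simp add: unit_polydisk_def less_imp_le)
      finally show ?thesis by simp
    qed
    then show "unit_polydisk \<subseteq> D" by (auto simp: D_def)
  qed (simp add: D_def)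
  show ?thesis
  proof
    assume "L2_inf (\<lambda>z. exp_neg c (w z))"
    then obtain K where K: "compact K" "(\<integral>\<^sup>+ z. exp_neg (2*c) (w z) * indicator (- K) z \<partial>lborel) < \<infinity>"
      unfolding L2_inf_def power2_exp_neg[OF c] by blast
    have "(\<integral>\<^sup>+ z. exp_neg (2*c) (w z) * indicator (- (K \<union> D)) z \<partial>lborel)
        \<le> (\<integral>\<^sup>+ z. exp_neg (2*c) (w z) * indicator (- K) z \<partial>lborel)"
      by (intro nn_integral_mono) (auto split: split_indicator)
    then have "(\<integral>\<^sup>+ z. exp_neg (2*c) (w z) * indicator (- (K \<union> D)) z \<partial>lborel) < \<infinity>"
      using K(2) by (rule le_less_trans)
    moreover have "unit_polydisk \<subseteq> K \<union> D" "compact (K \<union> D)" using D K(1) by auto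
    ultimately show "\<forall>t\<in>H_plus. t \<bullet> one_vec < c * \<psi> t"
      using nn_integral_finite_iff[OF w c] by blast
  next
    assume "\<forall>t\<in>H_plus. t \<bullet> one_vec < c * \<psi> t"
    then have "(\<integral>\<^sup>+ z. exp_neg (2*c) (w z) * indicator (- D) z \<partial>lborel) < \<infinity>"
      using nn_integral_finite_iff[OF w c D(2,1)] by blast
    then show "L2_inf (\<lambda>z. exp_neg c (w z))"
      unfolding L2_inf_def power2_exp_neg[OF c] using D(1) by blast
  qed
qed

lemma c_inf_eq:
  fixes w :: "complex^'n \<Rightarrow> ereal"
  assumes w: "\<And>z. z \<in> torus_free \<Longrightarrow> w z = ereal (f (ln_vec z))"
    and \<sigma>: "\<sigma> > 0" "\<And>c. c > 0 \<Longrightarrow> \<sigma> < c \<longleftrightarrow> (\<forall>t\<in>H_plus. t \<bullet> one_vec < c * \<psi> t)"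
  shows "c_inf w = ereal \<sigma>"
proof -
  have "{ereal c | c. c > 0 \<and> L2_inf (\<lambda>z. exp_neg c (w z))} = {ereal c | c. c > 0 \<and> c > \<sigma>}"
    using L2_inf_iff[OF w] \<sigma>(2) by blast
  then show ?thesis unfolding c_inf_def using Inf_ereal_greaterThan[OF \<sigma>(1)] by simp
qed

text \<open>Off \<open>H_plus\<close> the left side is nonpositive and the maximum with 0 makes the
  inequality automatic; on \<open>H_plus\<close> the maximum is \<open>\<psi> t\<close>
  itself.\<close>

lemma scaled_one_vec_in_diagram_iff:
  assumes "c > 0"
  shows "(\<forall>t. ((1 / c) *\<^sub>R one_vec) \<bullet> t \<le> max (\<psi> t) 0) \<longleftrightarrow> (\<forall>t\<in>H_plus. t \<bullet> one_vec \<le> c * \<psi> t)"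
proof -
  have "(((1 / c) *\<^sub>R one_vec) \<bullet> t \<le> max (\<psi> t) 0) \<longleftrightarrow> (t \<in> H_plus \<longrightarrow> t \<bullet> one_vec \<le> c * \<psi> t)" for t
  proof (cases "t \<in> H_plus")
    case True
    then have "\<psi> t > 0" by (intro \<psi>_pos_H_plus) (auto simp: H_plus_iff)
    then show ?thesis using True assms by (simp add: inner_commute[of one_vec] field_simps)
  next
    case False
    then have "((1 / c) *\<^sub>R one_vec) \<bullet> t \<le> 0"
      using assms by (simp add: H_plus_iff inner_commute[of one_vec] not_less divide_nonpos_pos)
    then show ?thesis using False by simp
  qed
  then show ?thesis by blast
qed

text \<open>An interior point can be pushed outwards along the diagonal, which improves the constant
  and, as \<open>\<psi>\<close> > 0 on \<open>H_plus\<close>, makes the inequality strict.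
  Conversely, strictness leaves a positive minimal gap on the unit sphere, and homogeneity turns
  this gap into the radius of a ball inside the diagram.\<close>

lemma scaled_one_vec_in_interior_diagram_iff:
  assumes c: "c > 0"
  shows "(1 / c) *\<^sub>R one_vec \<in> interior {a. \<forall>t. a \<bullet> t \<le> max (\<psi> t) 0}
      \<longleftrightarrow> (\<forall>t\<in>H_plus. t \<bullet> one_vec < c * \<psi> t)"
proof
  let ?\<Gamma> = "{a. \<forall>t. a \<bullet> t \<le> max (\<psi> t) 0}"
  assume "(1 / c) *\<^sub>R one_vec \<in> interior ?\<Gamma>"
  then obtain e where e: "e > 0" "ball ((1 / c) *\<^sub>R one_vec) e \<subseteq> ?\<Gamma>" by (auto simp: mem_interior)
  \<comment> \<open>Half the radius of the ball, measured along the diagonal, so that the shifted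
    point stays in the diagram.\<close>
  define a where "a = 1 / c + e / (2 * norm (one_vec :: real^'n))"
  have n: "norm (one_vec :: real^'n) > 0" by (simp add: one_vec_def vec_eq_iff)
  then have a: "a > 1 / c" using e(1) by (simp add: a_def)
  then have "a > 0" using c by (meson divide_pos_pos less_trans zero_less_one)
  have "dist ((1 / c) *\<^sub>R one_vec) (a *\<^sub>R (one_vec :: real^'n)) = \<bar>1 / c - a\<bar> * norm (one_vec :: real^'n)"
    by (simp add: dist_norm flip: scaleR_diff_left)
  also have "\<dots> = e / 2" using e(1) n by (simp add: a_def)
  finally have "a *\<^sub>R one_vec \<in> ?\<Gamma>" using e by (intro subsetD[OF e(2)]) simp
  then have "\<forall>t\<in>H_plus. t \<bullet> one_vec \<le> (1 / a) * \<psi> t"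
    using scaled_one_vec_in_diagram_iff[of "1 / a"] \<open>a > 0\<close> by simp
  moreover have "(1 / a) * \<psi> t < c * \<psi> t" if "t \<in> H_plus" for t
  proof -
    have "\<psi> t > 0" using that by (intro \<psi>_pos_H_plus) (auto simp: H_plus_iff)
    moreover have "1 / a < c" using a c \<open>a > 0\<close> by (simp add: field_simps)
    ultimately show ?thesis by (intro mult_strict_right_mono)
  qed
  ultimately show "\<forall>t\<in>H_plus. t \<bullet> one_vec < c * \<psi> t" by (meson le_less_trans)
next
  let ?\<Gamma> = "{a. \<forall>t. a \<bullet> t \<le> max (\<psi> t) 0}"
  assume crit: "\<forall>t\<in>H_plus. t \<bullet> one_vec < c * \<psi> t"
  define a where "a = (1 / c) *\<^sub>R (one_vec :: real^'n)"
  define g where "g = (\<lambda>t. max (\<psi> t) 0 - a \<bullet> t)"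
  \<comment> \<open>Strictness must hold in every direction: the hypothesis gives it on
    \<open>H_plus\<close>, positivity of \<open>\<psi>\<close> on the boundary hyperplane, and the
    sign of the linear form beyond it.\<close>
  have g_pos: "g t > 0" if "t \<noteq> 0" for t
  proof -
    have at: "a \<bullet> t = t \<bullet> one_vec / c" by (simp add: a_def inner_commute[of one_vec])
    consider "t \<bullet> one_vec > 0" | "t \<bullet> one_vec = 0" | "t \<bullet> one_vec < 0" by linarith
    then show ?thesis
    proof cases
      case 1
      then have "a \<bullet> t < \<psi> t" using crit c by (auto simp: at H_plus_iff pos_divide_less_eq mult.commute)
      then show ?thesis by (simp add: g_def)
    next
      case 2
      then show ?thesis using \<psi>_pos_H_plus[of t] that by (simp add: g_def at)
    next
      case 3
      then have "a \<bullet> t < 0" using c by (simp add: at divide_neg_pos)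
      then show ?thesis by (simp add: g_def)
    qed
  qed
  have "continuous_on (sphere 0 1) g"
    unfolding g_def by (intro continuous_intros continuous_\<psi>)
  moreover have "(1 / norm (one_vec :: real^'n)) *\<^sub>R one_vec \<in> sphere (0 :: real^'n) 1"
    by (simp add: one_vec_def vec_eq_iff)
  then have "sphere (0 :: real^'n) 1 \<noteq> {}" by blast
  ultimately obtain t0 where t0: "t0 \<in> sphere 0 1" "\<And>t. t \<in> sphere 0 1 \<Longrightarrow> g t0 \<le> g t"
    using continuous_attains_inf[OF compact_sphere] by blast
  have \<delta>: "g t0 > 0" using t0(1) by (intro g_pos) auto
  have "ball a (g t0) \<subseteq> ?\<Gamma>"
  proof
    fix a' assume "a' \<in> ball a (g t0)"
    then have d: "norm (a' - a) < g t0" by (simp add: dist_norm norm_minus_commute)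
    have "a' \<bullet> t \<le> max (\<psi> t) 0" for t
    proof (cases "t = 0")
      case False
      define s where "s = t /\<^sub>R norm t"
      have n: "norm t > 0" and s: "s \<in> sphere 0 1" "t = norm t *\<^sub>R s"
        using False by (auto simp: s_def)
      have "(a' - a) \<bullet> s \<le> norm (a' - a) * norm s" by (rule norm_cauchy_schwarz)
      then have "(a' - a) \<bullet> s \<le> g s" using d t0(2)[OF s(1)] s(1) by simp
      then have "a' \<bullet> s \<le> max (\<psi> s) 0" by (simp add: g_def inner_diff_left)
      then have "norm t * (a' \<bullet> s) \<le> norm t * max (\<psi> s) 0" using n by simp
      also have "\<dots> = max (norm t * \<psi> s) 0" using n by (simp add: max_mult_distrib_left)
      also have "norm t * \<psi> s = \<psi> t" using \<psi>_scaleR[OF n, of s] s(2) by simp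
      finally show ?thesis using s(2) by (metis inner_scaleR_right)
    qed (simp add: \<psi>_zero)
    then show "a' \<in> ?\<Gamma>" by simp
  qed
  then show "(1 / c) *\<^sub>R one_vec \<in> interior ?\<Gamma>"
    unfolding a_def[symmetric] using \<delta> by (auto simp: mem_interior)
qed

end

theorem theorem7p2:
  fixes u :: "complex^'n \<Rightarrow> ereal" and K :: "(complex^'n) set" and c :: real
  assumes "LPSH_star u" and "toric u"
    and "compact K" and "unit_polydisk \<subseteq> K"
    and "c > 0"
  shows "((\<integral>\<^sup>+ z. exp_neg (2*c) (u z) * indicator (- K) z \<partial>lborel) < \<infinity>
            \<longleftrightarrow> ereal c > (SUP t\<in>H_plus. ereal (t \<bullet> one_vec) / psi_ind u t))
       \<and> (ereal c > (SUP t\<in>H_plus. ereal (t \<bullet> one_vec) / psi_ind u t)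
            \<longleftrightarrow> (1 / c) *\<^sub>R one_vec \<in> interior (indicator_diagram_inf u))
       \<and> c_inf u = c_inf (log_indicator u)
       \<and> c_inf (log_indicator u) = (SUP t\<in>H_plus. ereal (t \<bullet> one_vec) / psi_ind u t)
       \<and> (SUP t\<in>H_plus. ereal (t \<bullet> one_vec) / psi_ind u t)
            = Inf {ereal c' | c'. c' > 0 \<and> (1 / c') *\<^sub>R one_vec \<in> indicator_diagram_inf u}"
proof -
  interpret u: toric_star u by standard fact+
  interpret \<phi>: recession u.\<phi> u.\<psi>
    by standard (use u.convex_\<phi> u.\<psi>_lim u.\<psi>_pos in auto)
  interpret \<psi>: recession u.\<psi> u.\<psi> by (rule \<phi>.recession_\<psi>)
  have u_torus: "u z = ereal (u.\<phi> (ln_vec z))" if "z \<in> torus_free" for z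
    using toric_eq_exp_ln_vec[OF assms(2) that] by (simp add: u.u_exp_vec)
  obtain \<sigma> where \<sigma>: "\<sigma> > 0" "(SUP t\<in>H_plus. ereal (t \<bullet> one_vec) / ereal (u.\<psi> t)) = ereal \<sigma>"
    and less: "\<And>c. c > 0 \<Longrightarrow> \<sigma> < c \<longleftrightarrow> (\<forall>t\<in>H_plus. t \<bullet> one_vec < c * u.\<psi> t)"
    and le: "\<And>c. c > 0 \<Longrightarrow> \<sigma> \<le> c \<longleftrightarrow> (\<forall>t\<in>H_plus. t \<bullet> one_vec \<le> c * u.\<psi> t)"
    using \<phi>.SUP_attained by blast
  have SUP: "(SUP t\<in>H_plus. ereal (t \<bullet> one_vec) / psi_ind u t) = ereal \<sigma>"
    unfolding u.psi_ind_eq by (rule \<sigma>(2))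
  have \<Gamma>: "indicator_diagram_inf u = {a. \<forall>t. a \<bullet> t \<le> max (u.\<psi> t) 0}"
    unfolding indicator_diagram_inf_def u.psi_ind_eq by (simp add: zero_ereal_def flip: ereal_max)
  \<comment> \<open>The diagram is described by nonstrict inequalities, so \<open>\<sigma>\<close>
    itself is admissible and the infimum is attained.\<close>
  have "Inf {ereal c' | c'. c' > 0 \<and> (1 / c') *\<^sub>R one_vec \<in> indicator_diagram_inf u} = ereal \<sigma>"
  proof (rule antisym)
    have iff: "(1 / c') *\<^sub>R one_vec \<in> indicator_diagram_inf u \<longleftrightarrow> \<sigma> \<le> c'" if "c' > 0" for c'
      using \<phi>.scaled_one_vec_in_diagram_iff[OF that] le[OF that] by (simp add: \<Gamma>)
    show "Inf {ereal c' | c'. c' > 0 \<and> (1 / c') *\<^sub>R one_vec \<in> indicator_diagram_inf u} \<le> ereal \<sigma>"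
      using \<sigma>(1) iff[OF \<sigma>(1)] by (intro Inf_lower) auto
    show "ereal \<sigma> \<le> Inf {ereal c' | c'. c' > 0 \<and> (1 / c') *\<^sub>R one_vec \<in> indicator_diagram_inf u}"
      using iff by (intro Inf_greatest) auto
  qed
  moreover have "c_inf u = ereal \<sigma>"
    by (rule \<phi>.c_inf_eq[OF u_torus \<sigma>(1) less])
  moreover have "c_inf (log_indicator u) = ereal \<sigma>"
    by (rule \<psi>.c_inf_eq[OF u.log_indicator_eq \<sigma>(1) less])
  moreover have "(\<integral>\<^sup>+ z. exp_neg (2*c) (u z) * indicator (- K) z \<partial>lborel) < \<infinity> \<longleftrightarrow> \<sigma> < c"
    unfolding less[OF assms(5)] by (rule \<phi>.nn_integral_finite_iff[OF u_torus assms(5,4,3)])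
  moreover have "\<sigma> < c \<longleftrightarrow> (1 / c) *\<^sub>R one_vec \<in> interior (indicator_diagram_inf u)"
    unfolding less[OF assms(5)] \<Gamma> by (rule \<phi>.scaled_one_vec_in_interior_diagram_iff[OF assms(5), symmetric])
  ultimately show ?thesis unfolding SUP by simp
qed

end
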